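(* For any $(p_{00},p_{01},p_{10},p_{11}) \in (0,1)^4$ such that $$2-r > \min\left(r^{(0)}_0,r^{(0)}_1\right) + \left(1-\gamma^{(0)}\right)\left|r^{(0)}_0 - r^{(0)}_1\right| + \min\left(r^{(1)}_0,r^{(1)}_1\right) + \left(1-\gamma^{(1)}\right)\left|r^{(1)}_0 - r^{(1)}_1\right|,$$ the PCA with parameter $(p_{00},p_{01},p_{10},p_{11})$ is ergodic. Here $r$, $r^{(i)}_x$ and $\gamma^{(i)}$ ($i,x \in \{0,1\}$) are the functions of $(p_{00},p_{01},p_{10},p_{11})$ defined in the context.
   Context: PCA. Let $(p_{00},p_{01},p_{10},p_{11}) \in [0,1]^4$. The probabilistic cellular automaton (PCA) with parameter $(p_{00},p_{01},p_{10},p_{11})$ is the Markov chain $X(t) = (X_i(t))_{i \in \mathbb{Z}}$, $t \in \mathbb{N} = \{0,1,2,\dots\}$, on $\{0,1\}^{\mathbb{Z}}$ such that, for all $t \in \mathbb{N}$, conditionally on $X(t)$, the random variables $(X_i(t+1))_{i \in \mathbb{Z}}$ are independent and, for each $i \in \mathbb{Z}$, $$X_i(t+1) = \begin{cases} 0 & \text{with probability } 1 - p_{X_i(t)X_{i+1}(t)},\\ 1 & \text{with probability } p_{X_i(t)X_{i+1}(t)}. \end{cases}$$ The chain starts from an initial condition $X(0)$, which may be deterministic or distributed according to an initial probability measure $\mu_0$ on $\{0,1\}^{\mathbb{Z}}$. Ergodicity. A PCA is called ergodic if there exists a probability measure $\mu_\infty$ on $\{0,1\}^{\mathbb{Z}}$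 such that, for any initial probability measure $\mu_0$ on $\{0,1\}^{\mathbb{Z}}$ with $X(0) \sim \mu_0$, the law $\mu_t$ of $X(t)$ converges weakly to $\mu_\infty$ as $t \to \infty$ ($\{0,1\}^{\mathbb{Z}}$ being equipped with the product topology). Notation. For $x \in \{0,1\}$, set - $p^{(0)}_x = \min(p_{x0},p_{x1})$, $q^{(0)}_x = 1 - \max(p_{x0},p_{x1})$, $r^{(0)}_x = 1 - p^{(0)}_x - q^{(0)}_x$; - $p^{(1)}_x = \min(p_{0x},p_{1x})$, $q^{(1)}_x = 1 - \max(p_{0x},p_{1x})$, $r^{(1)}_x = 1 - p^{(1)}_x - q^{(1)}_x$; - $p = \min(p_{00},p_{01},p_{10},p_{11})$, $q = 1 - \max(p_{00},p_{01},p_{10},p_{11})$, $r = 1 - p - q$. For $i,x \in \{0,1\}$, set $$P^{(i)}_x = r\,p^{(i)}_x + (1-r^{(i)}_x)\,p + r^{(i)}_x\,p^{(1-i)}_x, \qquad Q^{(i)}_x = r\,q^{(i)}_x + (1-r^{(i)}_x)\,q + r^{(i)}_x\,q^{(1-i)}_x.$$ For $i \in \{0,1\}$, the quantity $\gamma^{(i)}$ is defined as follows. If $r^{(i)}_0 \le r^{(i)}_1$: - if $Q^{(i)}_1 \le Q^{(i)}_0$ (whatever the order of $P^{(i)}_0$ and $P^{(i)}_1$): $\displaystyle \gamma^{(i)} = \frac{Q^{(i)}_1}{1 - (Q^{(i)}_0 - Q^{(i)}_1)}$; - if $Q^{(i)}_1 \ge Q^{(i)}_0$ and $P^{(i)}_0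 \le P^{(i)}_1$: $\displaystyle \gamma^{(i)} = \frac{Q^{(i)}_1 P^{(i)}_0 + Q^{(i)}_0 (1 - P^{(i)}_1)}{1 - (P^{(i)}_1 - P^{(i)}_0)}$; - if $Q^{(i)}_1 \ge Q^{(i)}_0$ and $P^{(i)}_0 \ge P^{(i)}_1$: $\displaystyle \gamma^{(i)} = \frac{Q^{(i)}_0 + P^{(i)}_1 (Q^{(i)}_1 - Q^{(i)}_0)}{1 - (Q^{(i)}_1 - Q^{(i)}_0)(P^{(i)}_0 - P^{(i)}_1)}$. If $r^{(i)}_0 \ge r^{(i)}_1$: - if $P^{(i)}_0 \le P^{(i)}_1$ (whatever the order of $Q^{(i)}_0$ and $Q^{(i)}_1$): $\displaystyle \gamma^{(i)} = \frac{P^{(i)}_0}{1 - (P^{(i)}_1 - P^{(i)}_0)}$; - if $P^{(i)}_0 \ge P^{(i)}_1$ and $Q^{(i)}_1 \le Q^{(i)}_0$: $\displaystyle \gamma^{(i)} = \frac{P^{(i)}_0 Q^{(i)}_1 + P^{(i)}_1 (1 - Q^{(i)}_0)}{1 - (Q^{(i)}_0 - Q^{(i)}_1)}$; - if $P^{(i)}_0 \ge P^{(i)}_1$ and $Q^{(i)}_1 \ge Q^{(i)}_0$: $\displaystyle \gamma^{(i)} = \frac{P^{(i)}_1 + Q^{(i)}_0 (P^{(i)}_0 - P^{(i)}_1)}{1 - (Q^{(i)}_1 - Q^{(i)}_0)(P^{(i)}_0 - P^{(i)}_1)}$. (When $r^{(i)}_0 = r^{(i)}_1$ the value of $\gamma^{(i)}$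 is irrelevant in the condition, since it is multiplied by $|r^{(i)}_0 - r^{(i)}_1| = 0$; within each of the two lists, the formulas agree when several cases apply.) *)

theory Defs
  imports "HOL-Probability.Probability"
begin

section \<open>Configurations and weak convergence\<close>

text \<open>
  The alphabet \<open>{0, 1}\<close> is \<open>bool\<close> (\<open>0\<close> is \<open>False\<close>, \<open>1\<close> is \<open>True\<close>), so a configuration is a function
  \<open>int \<Rightarrow> bool\<close>. The library gives \<open>bool\<close> the discrete topology and \<open>int \<Rightarrow> bool\<close> the product topology.
\<close>

type_synonym config = "int \<Rightarrow> bool"

definition configs :: "config measure" where
  "configs = Pi\<^sub>M UNIV (\<lambda>_. count_space UNIV)"

definition config_distribution :: "config measure \<Rightarrow> bool" where
  "config_distribution \<mu> \<longleftrightarrow> prob_space \<mu> \<and> sets \<mu> = sets configs"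

text \<open>
  The library's \<open>weak_conv_m\<close> is specific to the real line (it uses distribution functions), hence
  the usual definition by bounded continuous test functions.
\<close>

definition weakly_converges :: "(nat \<Rightarrow> 'a::topological_space measure) \<Rightarrow> 'a measure \<Rightarrow> bool" where
  "weakly_converges M \<mu> \<longleftrightarrow>
     (\<forall>f :: 'a \<Rightarrow> real. continuous_on UNIV f \<and> bounded (range f) \<longrightarrow>
        (\<lambda>t. \<integral>x. f x \<partial>M t) \<longlonglongrightarrow> (\<integral>x. f x \<partial>\<mu>))"

text \<open>The product sigma-algebra on configurations is the Borel one of the product topology.\<close>

instance bool :: second_countable_topology
proof
  have "open = generate_topology (UNIV :: bool set set)"
    by (auto simp: fun_eq_iff Topological_Spaces.open_discrete intro: generate_topology.Basis)
  then show "\<exists>B :: bool set set. countable B \<and> open = generate_topology B"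
    by (intro exI[of _ UNIV]) (simp add: countable_finite)
qed

lemma sets_configs: "sets configs = sets borel"
proof -
  have "sets configs = sets (Pi\<^sub>M UNIV (\<lambda>_::int. borel :: bool measure))"
    unfolding configs_def by (rule sets_PiM_cong) (simp_all add: sets_borel_eq_count_space)
  also have "\<dots> = sets borel"
    by (rule sets_PiM_equal_borel)
  finally show ?thesis .
qed

lemma space_configs [simp]: "space configs = UNIV"
  by (simp add: configs_def space_PiM)


section \<open>The probabilistic cellular automaton and its ergodicity\<close>

text \<open>
  The parameter \<open>(p\<^sub>0\<^sub>0, p\<^sub>0\<^sub>1, p\<^sub>1\<^sub>0, p\<^sub>1\<^sub>1)\<close> is a function \<open>p :: bool \<Rightarrow> bool \<Rightarrow> real\<close>, with \<open>p a b\<close> standing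
  for \<open>p\<^sub>a\<^sub>b\<close>. \<open>pca_kernel p x\<close> is the law of \<open>X(t+1)\<close> given \<open>X(t) = x\<close>: the product over the sites \<open>i\<close>
  of the Bernoulli laws with parameter \<open>p (x i) (x (i + 1))\<close>.
\<close>

definition pca_kernel :: "(bool \<Rightarrow> bool \<Rightarrow> real) \<Rightarrow> config \<Rightarrow> config measure" where
  "pca_kernel p x = Pi\<^sub>M UNIV (\<lambda>i. measure_pmf (bernoulli_pmf (p (x i) (x (i + 1)))))"

text \<open>\<open>pca_law p \<mu>0 t\<close> is the law of \<open>X(t)\<close> when \<open>X(0)\<close> has law \<open>\<mu>0\<close>.\<close>

primrec pca_law :: "(bool \<Rightarrow> bool \<Rightarrow> real) \<Rightarrow> config measure \<Rightarrow> nat \<Rightarrow> config measure" where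
  "pca_law p \<mu>0 0 = \<mu>0"
| "pca_law p \<mu>0 (Suc t) = pca_law p \<mu>0 t \<bind> pca_kernel p"

definition pca_ergodic :: "(bool \<Rightarrow> bool \<Rightarrow> real) \<Rightarrow> bool" where
  "pca_ergodic p \<longleftrightarrow>
     (\<exists>\<mu>_inf. config_distribution \<mu>_inf \<and>
        (\<forall>\<mu>0. config_distribution \<mu>0 \<longrightarrow> weakly_converges (pca_law p \<mu>0) \<mu>_inf))"

text \<open>
  The kernel is measurable, so that the monadic bind above is the genuine composition of a law with
  a Markov kernel, and every \<open>pca_law p \<mu>0 t\<close> is a probability measure on configurations.
\<close>

lemma sets_pca_kernel: "sets (pca_kernel p x) = sets configs"
  unfolding pca_kernel_def configs_def by (rule sets_PiM_cong) simp_all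

lemma prob_space_pca_kernel: "prob_space (pca_kernel p x)"
  unfolding pca_kernel_def by (intro prob_space_PiM measure_pmf.prob_space_axioms)

lemma measurable_pca_kernel: "pca_kernel p \<in> configs \<rightarrow>\<^sub>M prob_algebra configs"
proof (rule measurable_prob_algebra_generated)
  let ?N = "\<lambda>_::int. count_space (UNIV :: bool set)"
  show "sets configs = sigma_sets (\<Pi>\<^sub>E i\<in>UNIV. space (?N i)) (prod_algebra UNIV ?N)"
    unfolding configs_def by (rule sets_PiM)
  show "Int_stable (prod_algebra UNIV ?N)"
    by (rule Int_stable_prod_algebra)
  show "prod_algebra UNIV ?N \<subseteq> Pow (\<Pi>\<^sub>E i\<in>UNIV. space (?N i))"
    by (rule prod_algebra_sets_into_space)
  show "prob_space (pca_kernel p x)" for x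
    by (rule prob_space_pca_kernel)
  show "sets (pca_kernel p x) = sets configs" for x
    by (rule sets_pca_kernel)
  fix A assume "A \<in> prod_algebra UNIV ?N"
  then obtain J E where A: "A = prod_emb UNIV ?N J (\<Pi>\<^sub>E j\<in>J. E j)" and J: "finite J"
    by (rule prod_algebraE)
  have "emeasure (pca_kernel p x) A =
      (\<Prod>j\<in>J. emeasure (measure_pmf (bernoulli_pmf (p (x j) (x (j + 1))))) (E j))" for x
  proof -
    have "A = prod_emb UNIV (\<lambda>i. measure_pmf (bernoulli_pmf (p (x i) (x (i + 1))))) J (\<Pi>\<^sub>E j\<in>J. E j)"
      by (simp add: A prod_emb_def)
    then show ?thesis
      unfolding pca_kernel_def using J
      by (simp add: emeasure_PiM_emb measure_pmf.prob_space_axioms)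
  qed
  moreover have comp: "(\<lambda>x. x i) \<in> configs \<rightarrow>\<^sub>M count_space UNIV" for i
    unfolding configs_def by (rule measurable_component_singleton) simp
  have "(\<lambda>x. emeasure (measure_pmf (bernoulli_pmf (p (x j) (x (j + 1))))) (E j))
      \<in> borel_measurable configs" for j
    by (rule measurable_compose_countable[where g = "\<lambda>x. x j",
          OF measurable_compose_countable[where g = "\<lambda>x. x (j + 1)", OF measurable_const comp] comp])
      simp
  ultimately show "(\<lambda>x. emeasure (pca_kernel p x) A) \<in> borel_measurable configs"
    by (simp add: borel_measurable_prod_ennreal)
qed

lemma config_distribution_pca_law:
  assumes "config_distribution \<mu>0"
  shows "config_distribution (pca_law p \<mu>0 t)"
proof -
  have "pca_law p \<mu>0 t \<in> space (prob_algebra configs)"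
  proof (induction t)
    case 0
    show ?case using assms by (simp add: config_distribution_def space_prob_algebra)
  next
    case (Suc t)
    show ?case
      using prob_space_bind'[OF Suc measurable_pca_kernel] sets_bind'[OF Suc measurable_pca_kernel]
      by (simp add: space_prob_algebra)
  qed
  then show ?thesis
    by (simp add: config_distribution_def space_prob_algebra)
qed


section \<open>The quantities in the ergodicity criterion\<close>

text \<open>
  Both the superscript \<open>i\<close> and the index \<open>x\<close> range over \<open>bool\<close>, and \<open>1 - i\<close> is \<open>\<not> i\<close>.
  \<open>par_at p i x y\<close> is \<open>p\<^sub>x\<^sub>y\<close> for \<open>i = 0\<close> and \<open>p\<^sub>y\<^sub>x\<close> for \<open>i = 1\<close>; thus \<open>p_sup\<close>, \<open>q_sup\<close>, \<open>r_sup\<close>, \<open>P_sup\<close>, \<open>Q_sup\<close> with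
  arguments \<open>p i x\<close> are the quantities with superscript (hence \<open>_sup\<close>) \<open>(i)\<close> and subscript \<open>x\<close>, and \<open>p_all\<close>, \<open>q_all\<close>,
  \<open>r_all\<close> are those written \<open>p\<close>, \<open>q\<close>, \<open>r\<close> without indices.
\<close>

definition par_at :: "(bool \<Rightarrow> bool \<Rightarrow> real) \<Rightarrow> bool \<Rightarrow> bool \<Rightarrow> bool \<Rightarrow> real" where
  "par_at p i x y = (if i then p y x else p x y)"

definition p_sup :: "(bool \<Rightarrow> bool \<Rightarrow> real) \<Rightarrow> bool \<Rightarrow> bool \<Rightarrow> real" where
  "p_sup p i x = min (par_at p i x False) (par_at p i x True)"

definition q_sup :: "(bool \<Rightarrow> bool \<Rightarrow> real) \<Rightarrow> bool \<Rightarrow> bool \<Rightarrow> real" where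
  "q_sup p i x = 1 - max (par_at p i x False) (par_at p i x True)"

definition r_sup :: "(bool \<Rightarrow> bool \<Rightarrow> real) \<Rightarrow> bool \<Rightarrow> bool \<Rightarrow> real" where
  "r_sup p i x = 1 - p_sup p i x - q_sup p i x"

definition p_all :: "(bool \<Rightarrow> bool \<Rightarrow> real) \<Rightarrow> real" where
  "p_all p = Min {p False False, p False True, p True False, p True True}"

definition q_all :: "(bool \<Rightarrow> bool \<Rightarrow> real) \<Rightarrow> real" where
  "q_all p = 1 - Max {p False False, p False True, p True False, p True True}"

definition r_all :: "(bool \<Rightarrow> bool \<Rightarrow> real) \<Rightarrow> real" where
  "r_all p = 1 - p_all p - q_all p"

definition P_sup :: "(bool \<Rightarrow> bool \<Rightarrow> real) \<Rightarrow> bool \<Rightarrow> bool \<Rightarrow> real" where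
  "P_sup p i x = r_all p * p_sup p i x + (1 - r_sup p i x) * p_all p + r_sup p i x * p_sup p (\<not> i) x"

definition Q_sup :: "(bool \<Rightarrow> bool \<Rightarrow> real) \<Rightarrow> bool \<Rightarrow> bool \<Rightarrow> real" where
  "Q_sup p i x = r_all p * q_sup p i x + (1 - r_sup p i x) * q_all p + r_sup p i x * q_sup p (\<not> i) x"

text \<open>
  In the case distinctions below the formulas agree where non-strict cases overlap, except when
  \<open>r_sup p i False = r_sup p i True\<close>; there the value of \<open>\<gamma>\<close> only occurs multiplied by zero.
\<close>

definition gamma_sup :: "(bool \<Rightarrow> bool \<Rightarrow> real) \<Rightarrow> bool \<Rightarrow> real" where
  "gamma_sup p i =
     (let P0 = P_sup p i False; P1 = P_sup p i True; Q0 = Q_sup p i False; Q1 = Q_sup p i True in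
      if r_sup p i False \<le> r_sup p i True then
        (if Q1 \<le> Q0 then Q1 / (1 - (Q0 - Q1))
         else if P0 \<le> P1 then (Q1 * P0 + Q0 * (1 - P1)) / (1 - (P1 - P0))
         else (Q0 + P1 * (Q1 - Q0)) / (1 - (Q1 - Q0) * (P0 - P1)))
      else
        (if P0 \<le> P1 then P0 / (1 - (P1 - P0))
         else if Q1 \<le> Q0 then (P0 * Q1 + P1 * (1 - Q0)) / (1 - (Q0 - Q1))
         else (P1 + Q0 * (P0 - P1)) / (1 - (Q1 - Q0) * (P0 - P1))))"

end

theory Submission
  imports Defs
begin

text \<open>
  Run the automaton from two initial configurations with the same uniform noise, and let \<open>[L, R]\<close> be an
  interval off which they agree. One step only needs the two letters \<open>a\<close>, \<open>b\<close> bordering the interval: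
  treat every site inside as unknown. The new left end is found by scanning from site \<open>L - 1\<close> to the
  right for the first site whose new value is not forced. That site is \<open>L - 1\<close> with probability
  \<open>r\<^sup>(\<^sup>0\<^sup>)\<^sub>a\<close>, and otherwise each further site is unforced with probability \<open>r\<close>; so the left end moves on
  average by \<open>-1 + (1 - r\<^sup>(\<^sup>0\<^sup>)\<^sub>a) / r\<close>. Symmetrically on the right with \<open>r\<^sup>(\<^sup>1\<^sup>)\<^sub>b\<close>, and the length has negative drift
  iff \<open>2 - r > r\<^sup>(\<^sup>0\<^sup>)\<^sub>a + r\<^sup>(\<^sup>1\<^sup>)\<^sub>b\<close>. The bordering letters change too: whatever lies beyond them, the next letter
  is \<open>1\<close> with probability at least \<open>P\<^sub>a\<close> and \<open>0\<close> with probability at least \<open>Q\<^sub>a\<close>, so a corrector depending on the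
  letter (the Poisson equation of the extremal two-state chain) replaces \<open>r\<^sub>a\<close> by its worst average, in which
  the letter with the smaller rate has frequency at least \<open>\<gamma>\<close>.

  An exponential of length plus correctors is then contracted in mean. Hence the influence of a single
  site on a local observable at time \<open>t\<close> is \<open>O(\<rho>\<^sup>t)\<close>; only \<open>O(t)\<close> sites matter, so changing them one by one
  shows that the law at time \<open>t\<close> forgets the initial configuration. The limit law is a subsequential
  limit, obtained by embedding the configurations as a Cantor set in the line and using Helly selection.
\<close>

section \<open>The coupling by common noise\<close>

definition noise :: "real measure" where
  "noise = uniform_measure lborel {0..<1}"

definition noise_field :: "(int \<Rightarrow> real) measure" where
  "noise_field = Pi\<^sub>M UNIV (\<lambda>_. noise)"

text \<open>Feeding one noise field to two configurations couples their next steps. Since the noise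
  is uniform on \<open>{0..<1}\<close>, a rate in the unit interval is exactly the probability of a
  1.\<close>

definition update :: "(bool \<Rightarrow> bool \<Rightarrow> real) \<Rightarrow> config \<Rightarrow> (int \<Rightarrow> real) \<Rightarrow> config" where
  "update p \<eta> U = (\<lambda>i. U i < p (\<eta> i) (\<eta> (i + 1)))"

lemma prob_space_noise: "prob_space noise"
  unfolding noise_def by (rule prob_space_uniform_measure) auto

lemma sets_noise [simp, measurable_cong]: "sets noise = sets borel"
  by (simp add: noise_def)

lemma space_noise [simp]: "space noise = UNIV"
  by (simp add: noise_def)

lemma measure_noise: "A \<in> sets borel \<Longrightarrow> measure noise A = measure lborel ({0..<1} \<inter> A)"
  by (simp add: noise_def measure_uniform_measure)

lemma measure_noise_lessThan:
  assumes "0 \<le> c" "c \<le> 1"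
  shows "measure noise {..<c} = c"
proof -
  have "{0..<1} \<inter> {..<c} = {0..<c}" using assms by auto
  then show ?thesis using assms by (simp add: measure_noise)
qed

lemma measure_noise_atLeast:
  assumes "0 \<le> c" "c \<le> 1"
  shows "measure noise {c..} = 1 - c"
proof -
  have "{0..<1} \<inter> {c..} = {c..<1}" using assms by auto
  then show ?thesis using assms by (simp add: measure_noise)
qed

lemma measure_noise_atLeastLessThan:
  assumes "0 \<le> a" "a \<le> b" "b \<le> 1"
  shows "measure noise {a..<b} = b - a"
proof -
  have "{0..<1} \<inter> {a..<b} = {a..<b}" using assms by auto
  then show ?thesis using assms by (simp add: measure_noise)
qed

lemma measure_noise_gap:
  assumes "0 \<le> a" "a \<le> b" "b \<le> 1"
  shows "measure noise ({..<a} \<union> {b..}) = 1 - (b - a)"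
proof -
  interpret prob_space noise by (rule prob_space_noise)
  have "{..<a} \<union> {b..} = space noise - {a..<b}" using assms by auto
  then show ?thesis
    using prob_compl[of "{a..<b}"] assms by (simp add: measure_noise_atLeastLessThan)
qed

lemma product_prob_space_noise: "product_prob_space (\<lambda>_ :: int. noise)"
  by (simp add: product_prob_space_def product_sigma_finite_def product_prob_space_axioms_def
      prob_space_noise prob_space_imp_sigma_finite)

lemma prob_space_noise_field: "prob_space noise_field"
  unfolding noise_field_def by (intro prob_space_PiM prob_space_noise)

lemma space_noise_field [simp]: "space noise_field = UNIV"
  by (simp add: noise_field_def space_PiM)

lemma noise_component [measurable]: "(\<lambda>U. U i) \<in> borel_measurable noise_field"
  using measurable_component_singleton[of i UNIV "\<lambda>_. noise"]
  by (simp add: noise_field_def cong: measurable_cong_sets)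

lemma cylinder_sets:
  assumes "finite J" and [measurable]: "\<And>i. i \<in> J \<Longrightarrow> E i \<in> sets borel"
  shows "{U. \<forall>i\<in>J. U i \<in> E i} \<in> sets noise_field"
proof -
  have "{U \<in> space noise_field. \<forall>i\<in>J. U i \<in> E i} \<in> sets noise_field"
    using assms(1) by (intro sets.sets_Collect_finite_All) (use measurable_sets[OF noise_component assms(2)] in \<open>auto simp: vimage_def\<close>)
  then show ?thesis by simp
qed

lemma measure_cylinder:
  assumes "finite J" "\<And>i. i \<in> J \<Longrightarrow> E i \<in> sets borel"
  shows "measure noise_field {U. \<forall>i\<in>J. U i \<in> E i} = (\<Prod>i\<in>J. measure noise (E i))"
proof -
  interpret product_prob_space "\<lambda>_ :: int. noise" UNIV by (rule product_prob_space_noise)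
  have "{U. \<forall>i\<in>J. U i \<in> E i} = prod_emb UNIV (\<lambda>_. noise) J (Pi\<^sub>E J E)"
    by (auto simp: prod_emb_def PiE_def Pi_def)
  then show ?thesis
    using measure_PiM_emb[of J E] assms by (simp add: noise_field_def)
qed

lemma update_measurable: "update p \<eta> \<in> noise_field \<rightarrow>\<^sub>M configs"
  unfolding configs_def update_def
  by (rule measurable_PiM_single') (auto simp: space_PiM)

text \<open>Both laws give the same product of one-site probabilities on every cylinder; at one site
  only the four subsets of \<open>bool\<close> have to be compared.\<close>

lemma pca_kernel_eq_distr:
  assumes "\<And>a b. 0 \<le> p a b \<and> p a b \<le> 1"
  shows "pca_kernel p \<eta> = distr noise_field configs (update p \<eta>)"
proof -
  define B where "B = (\<lambda>i. measure_pmf (bernoulli_pmf (p (\<eta> i) (\<eta> (i + 1)))))"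
  interpret N: prob_space noise by (rule prob_space_noise)
  interpret F: prob_space noise_field by (rule prob_space_noise_field)
  have one_site: "emeasure noise {u. (u < p a b) \<in> A} = emeasure (measure_pmf (bernoulli_pmf (p a b))) A"
    for a b and A :: "bool set"
  proof -
    let ?c = "p a b"
    have c: "0 \<le> ?c" "?c \<le> 1" using assms by auto
    have A: "A = {} \<or> A = UNIV \<or> A = {True} \<or> A = {False}"
      by (metis (full_types) UNIV_bool UNIV_eq_I insert_absorb insert_iff is_singletonI' is_singleton_def)
    have 1: "{u. u < ?c} = {..<?c}" "{u. \<not> u < ?c} = {?c..}" by auto
    show ?thesis
      using A c
    proof (elim disjE)
      assume "A = UNIV"
      then show ?thesis using N.emeasure_space_1 by (simp add: measure_pmf.emeasure_space_1)
    qed (auto simp: 1 N.emeasure_eq_measure measure_noise_lessThan measure_noise_atLeast emeasure_pmf_single)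
  qed
  have "distr noise_field configs (update p \<eta>) = Pi\<^sub>M UNIV B"
  proof (rule measure_eqI_PiM_infinite[where M = B and I = UNIV])
    show "sets (distr noise_field configs (update p \<eta>)) = sets (Pi\<^sub>M UNIV B)"
      unfolding B_def using sets_pca_kernel[of p \<eta>] by (simp add: pca_kernel_def)
    show "finite_measure (distr noise_field configs (update p \<eta>))"
      by (intro prob_space.finite_measure F.prob_space_distr update_measurable)
    fix A J assume J: "finite J" "J \<subseteq> (UNIV :: int set)"
    have eq: "prod_emb UNIV B J (Pi\<^sub>E J A) = prod_emb UNIV (\<lambda>_. count_space UNIV) J (Pi\<^sub>E J A)"
      by (simp add: prod_emb_def B_def)
    have S: "prod_emb UNIV B J (Pi\<^sub>E J A) \<in> sets configs"
      unfolding eq configs_def using J by (intro sets_PiM_I) auto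
    have pre: "update p \<eta> -` prod_emb UNIV B J (Pi\<^sub>E J A)
        = {U. \<forall>i\<in>J. U i \<in> {u. (u < p (\<eta> i) (\<eta> (i + 1))) \<in> A i}}"
      by (auto simp: prod_emb_def B_def update_def PiE_def Pi_def space_PiM)
    have m: "{u. (u < c) \<in> X} \<in> sets borel" for c :: real and X
      by measurable
    have "emeasure (distr noise_field configs (update p \<eta>)) (prod_emb UNIV B J (Pi\<^sub>E J A))
        = emeasure noise_field {U. \<forall>i\<in>J. U i \<in> {u. (u < p (\<eta> i) (\<eta> (i + 1))) \<in> A i}}"
      using S by (subst emeasure_distr[OF update_measurable S]) (simp add: pre)
    also have "\<dots> = (\<Prod>i\<in>J. emeasure noise {u. (u < p (\<eta> i) (\<eta> (i + 1))) \<in> A i})"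
      unfolding F.emeasure_eq_measure N.emeasure_eq_measure
      by (subst measure_cylinder[OF J(1)], rule m) (simp add: prod_ennreal)
    also have "\<dots> = (\<Prod>i\<in>J. emeasure (B i) (A i))"
      unfolding one_site B_def ..
    also have "\<dots> = emeasure (Pi\<^sub>M UNIV B) (prod_emb UNIV B J (Pi\<^sub>E J A))"
      using J by (intro emeasure_PiM_emb[symmetric]) (auto simp: B_def measure_pmf.prob_space_axioms)
    finally show "emeasure (distr noise_field configs (update p \<eta>)) (prod_emb UNIV B J (Pi\<^sub>E J A)) =
       emeasure (Pi\<^sub>M UNIV B) (prod_emb UNIV B J (Pi\<^sub>E J A))" .
  qed simp
  then show ?thesis by (simp add: pca_kernel_def B_def)
qed

lemma integral_pca_kernel:
  fixes f :: "config \<Rightarrow> real"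
  assumes "\<And>a b. 0 \<le> p a b \<and> p a b \<le> 1" and "f \<in> borel_measurable configs"
  shows "(\<integral>x. f x \<partial>pca_kernel p \<eta>) = (\<integral>U. f (update p \<eta> U) \<partial>noise_field)"
  unfolding pca_kernel_eq_distr[OF assms(1)] using assms(2) update_measurable by (rule integral_distr[rotated])

section \<open>Scanning for the first unforced site\<close>

text \<open>
  Site \<open>j\<close> of a scan is forced to be \<open>1\<close> if its noise is below \<open>lo j\<close>, forced to be \<open>0\<close> if it is at least
  \<open>hi j\<close>, and unforced in between. The scan of the sites \<open>0, \<dots>, K\<close> has outcome \<open>(k, x)\<close> if the noise of site
  \<open>j\<close> lies in \<open>scan_set lo hi k x j\<close> for all \<open>j \<le> K\<close>: the sites up to \<open>k\<close> are forced, the last one to \<open>x\<close>, and either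
  site \<open>k + 1\<close> is unforced or \<open>k = K\<close>. Site \<open>0\<close>, the one just outside the border letter, always is
  forced (\<open>lo 0 = hi 0\<close>).
\<close>

definition scan_set :: "(nat \<Rightarrow> real) \<Rightarrow> (nat \<Rightarrow> real) \<Rightarrow> nat \<Rightarrow> bool \<Rightarrow> nat \<Rightarrow> real set" where
  "scan_set lo hi k x j =
     (if j < k then {..<lo j} \<union> {hi j..}
      else if j = k then (if x then {..<lo j} else {hi j..})
      else if j = Suc k then {lo j..<hi j}
      else UNIV)"

definition scan_prob :: "(nat \<Rightarrow> real) \<Rightarrow> (nat \<Rightarrow> real) \<Rightarrow> nat \<Rightarrow> nat \<Rightarrow> bool \<Rightarrow> real" where
  "scan_prob lo hi K k x =
     (\<Prod>j<k. 1 - (hi j - lo j)) * (if x then lo k else 1 - hi k) *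
     (if k < K then hi (Suc k) - lo (Suc k) else 1)"

lemma scan_set_borel [simp]: "scan_set lo hi k x j \<in> sets borel"
  by (simp add: scan_set_def)

lemma scan_outcome_exists:
  fixes u :: "nat \<Rightarrow> real"
  assumes "lo 0 = hi 0"
  shows "\<exists>k\<le>K. \<exists>x. \<forall>j\<le>K. u j \<in> scan_set lo hi k x j"
proof (induction K)
  case 0
  show ?case
    using assms by (intro exI[of _ 0] conjI exI[of _ "u 0 < lo 0"]) (auto simp: scan_set_def)
next
  case (Suc K)
  then obtain k x where k: "k \<le> K" and x: "\<And>j. j \<le> K \<Longrightarrow> u j \<in> scan_set lo hi k x j" by blast
  show ?case
  \<comment> \<open>If the scan stopped earlier, or site \<open>Suc K\<close> is unforced, the
    outcome is kept; otherwise the forced site \<open>Suc K\<close> becomes the last one.\<close>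
  proof (cases "k < K \<or> u (Suc K) \<in> {lo (Suc K)..<hi (Suc K)}")
    case True
    have "u j \<in> scan_set lo hi k x j" if "j \<le> Suc K" for j
      using that x[of j] True k by (cases "j = Suc K") (auto simp: scan_set_def)
    then show ?thesis using k by (intro exI[of _ k]) auto
  next
    case False
    with k have [simp]: "k = K" by simp
    have "u j \<in> scan_set lo hi (Suc K) (u (Suc K) < lo (Suc K)) j" if "j \<le> Suc K" for j
      using that x[of j] False
      by (cases "j = Suc K"; cases "j = K") (auto simp: scan_set_def split: if_splits)
    then show ?thesis by blast
  qed
qed

lemma scan_prob_eq_measure:
  assumes "k \<le> K" and lh: "\<And>j. 0 \<le> lo j \<and> lo j \<le> hi j \<and> hi j \<le> 1"
  shows "(\<Prod>j\<le>K. measure noise (scan_set lo hi k x j)) = scan_prob lo hi K k x"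
proof -
  interpret prob_space noise by (rule prob_space_noise)
  let ?f = "\<lambda>j. measure noise (scan_set lo hi k x j)"
  have 1: "?f j = 1 - (hi j - lo j)" if "j < k" for j
    using that lh[of j] by (simp add: scan_set_def measure_noise_gap)
  have 2: "?f k = (if x then lo k else 1 - hi k)"
    using lh[of k] order_trans[of 0 "lo k" "hi k"] order_trans[of "lo k" "hi k" 1]
    by (simp add: scan_set_def measure_noise_lessThan measure_noise_atLeast)
  have 3: "?f (Suc k) = hi (Suc k) - lo (Suc k)"
    using lh[of "Suc k"] by (simp add: scan_set_def measure_noise_atLeastLessThan)
  have 4: "?f j = 1" if "Suc k < j" for j
    using that prob_space by (simp add: scan_set_def)
  have init: "prod ?f {..k} = (\<Prod>j<k. 1 - (hi j - lo j)) * (if x then lo k else 1 - hi k)"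
  proof -
    have "{..k} = insert k {..<k}" by auto
    then show ?thesis by (simp add: 1 2 mult.commute)
  qed
  show ?thesis
  proof (cases "k = K")
    case True
    then show ?thesis using init by (simp add: scan_prob_def)
  next
    case False
    then have "k < K" using assms(1) by simp
    then have split: "{..K} = {..k} \<union> insert (Suc k) {Suc (Suc k)..K}" by auto
    have "prod ?f {..K} = prod ?f {..k} * prod ?f (insert (Suc k) {Suc (Suc k)..K})"
      unfolding split by (rule prod.union_disjoint) auto
    also have "prod ?f (insert (Suc k) {Suc (Suc k)..K}) = hi (Suc k) - lo (Suc k)"
      by (simp add: 3 4)
    finally show ?thesis using init \<open>k < K\<close> by (simp add: scan_prob_def)
  qed
qed

lemma scan_prob_nonneg:
  assumes "\<And>j. 0 \<le> lo j \<and> lo j \<le> hi j \<and> hi j \<le> 1"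
  shows "0 \<le> scan_prob lo hi K k x"
  unfolding scan_prob_def
proof (intro mult_nonneg_nonneg prod_nonneg)
  fix j
  have "0 \<le> lo j" "hi j \<le> 1" using assms by auto
  then show "0 \<le> 1 - (hi j - lo j)" by linarith
qed (use assms in auto)

lemma scan_prob_Suc:
  "k < K \<Longrightarrow> scan_prob lo hi (Suc K) k x = scan_prob lo hi K k x"
  "scan_prob lo hi (Suc K) K x = scan_prob lo hi K K x * (hi (Suc K) - lo (Suc K))"
  by (simp_all add: scan_prob_def)

text \<open>One more site only splits the outcomes with \<open>k = K\<close>: they keep the share
  where site \<open>Suc K\<close> is unforced, and the mass they lose goes to
  \<open>k = Suc K\<close>.\<close>

lemma scan_sum_Suc:
  fixes f :: "nat \<Rightarrow> bool \<Rightarrow> real"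
  shows "(\<Sum>k\<le>Suc K. scan_prob lo hi (Suc K) k x * f k x) =
    (\<Sum>k\<le>K. scan_prob lo hi K k x * f k x)
     + scan_prob lo hi (Suc K) (Suc K) x * f (Suc K) x
     - scan_prob lo hi K K x * (1 - (hi (Suc K) - lo (Suc K))) * f K x"
proof -
  have *: "{..K} = insert K {..<K}" by auto
  show ?thesis by (simp add: * scan_prob_Suc algebra_simps)
qed

lemma scan_prob_last:
  "scan_prob lo hi K K True + scan_prob lo hi K K False = (\<Prod>j\<le>K. 1 - (hi j - lo j))"
proof -
  have *: "{..K} = insert K {..<K}" by auto
  show ?thesis by (simp add: * scan_prob_def algebra_simps)
qed

lemma scan_mass:
  assumes "lo 0 = hi 0"
  shows "(\<Sum>k\<le>K. scan_prob lo hi K k True) + (\<Sum>k\<le>K. scan_prob lo hi K k False) = 1"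
proof (induction K)
  case 0
  show ?case using assms by (simp add: scan_prob_def)
next
  case (Suc K)
  have "(\<Sum>k\<le>Suc K. scan_prob lo hi (Suc K) k True) + (\<Sum>k\<le>Suc K. scan_prob lo hi (Suc K) k False)
    = (\<Sum>k\<le>K. scan_prob lo hi K k True) + (\<Sum>k\<le>K. scan_prob lo hi K k False)
      + (scan_prob lo hi (Suc K) (Suc K) True + scan_prob lo hi (Suc K) (Suc K) False)
      - (scan_prob lo hi K K True + scan_prob lo hi K K False) * (1 - (hi (Suc K) - lo (Suc K)))"
    using scan_sum_Suc[of lo hi K True "\<lambda>_ _. 1"] scan_sum_Suc[of lo hi K False "\<lambda>_ _. 1"]
    by (simp add: algebra_simps)
  then show ?case using Suc by (simp add: scan_prob_last)
qed

text \<open>Tail-sum formula for the expectation of \<open>k\<close>: the product is the probability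
  that sites \<open>0\<close> to \<open>Suc i\<close> are all forced, that is,
  \<open>k > i\<close>.\<close>

lemma scan_mean:
  "(\<Sum>k\<le>K. scan_prob lo hi K k True * real k) + (\<Sum>k\<le>K. scan_prob lo hi K k False * real k)
   = (\<Sum>i<K. \<Prod>j\<le>Suc i. 1 - (hi j - lo j))"
proof (induction K)
  case 0
  show ?case by simp
next
  case (Suc K)
  have "(\<Sum>k\<le>Suc K. scan_prob lo hi (Suc K) k True * real k) + (\<Sum>k\<le>Suc K. scan_prob lo hi (Suc K) k False * real k)
    = (\<Sum>k\<le>K. scan_prob lo hi K k True * real k) + (\<Sum>k\<le>K. scan_prob lo hi K k False * real k)
      + (scan_prob lo hi (Suc K) (Suc K) True + scan_prob lo hi (Suc K) (Suc K) False) * real (Suc K)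
      - (scan_prob lo hi K K True + scan_prob lo hi K K False) * (1 - (hi (Suc K) - lo (Suc K))) * real K"
    unfolding scan_sum_Suc[of lo hi K _ "\<lambda>k _. real k"] by (simp only: algebra_simps)
  also have "\<dots> = (\<Sum>i<K. \<Prod>j\<le>Suc i. 1 - (hi j - lo j)) + (\<Prod>j\<le>Suc K. 1 - (hi j - lo j))"
    unfolding Suc scan_prob_last by (simp add: algebra_simps)
  finally show ?case by simp
qed

text \<open>The three terms come from \<open>k = 0\<close>, \<open>k = 1\<close> and
  \<open>k \<ge> 2\<close>. From site 2 on the thresholds are constant, so it does not matter for
  the letter where the scan stops, and the sum is the same for all \<open>K \<ge> 2\<close>.\<close>

lemma scan_letter:
  assumes "2 \<le> K" and lo: "\<And>j. 2 \<le> j \<Longrightarrow> lo j = l" and hi: "\<And>j. 2 \<le> j \<Longrightarrow> hi j = h"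
    and "lo 0 = hi 0"
  shows "(\<Sum>k\<le>K. scan_prob lo hi K k True)
    = lo 0 * (hi 1 - lo 1) + lo 1 * (h - l) + (1 - (hi 1 - lo 1)) * l"
  using \<open>2 \<le> K\<close>
proof (induction K rule: dec_induct)
  case base
  have "{..2 :: nat} = {0, 1, 2}" "{..<2 :: nat} = {0, 1}" by auto
  then show ?case
    using assms(4) lo[of 2] hi[of 2] by (simp add: scan_prob_def numeral_2_eq_2)
next
  case (step K)
  have "(\<Prod>j<Suc K. 1 - (hi j - lo j)) = (\<Prod>j<K. 1 - (hi j - lo j)) * (1 - (h - l))"
    using lo[of K] hi[of K] step by simp
  then have "scan_prob lo hi (Suc K) (Suc K) True
      = scan_prob lo hi K K True * (1 - (hi (Suc K) - lo (Suc K)))"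
    using lo[of K] hi[of K] lo[of "Suc K"] hi[of "Suc K"] step by (simp add: scan_prob_def)
  then show ?case
    using scan_sum_Suc[of lo hi K True "\<lambda>_ _. 1"] step by simp
qed

text \<open>
  The first formula for \<open>\<gamma>\<close> is the frequency of the letter \<open>0\<close> in the two-state chain that makes it smallest.
  It dominates the formulas of the other cases, so only this one is needed. The lemma is also used with the
  letters exchanged, i.e. with \<open>Q\<^sub>1\<close>, \<open>Q\<^sub>0\<close>, \<open>P\<^sub>1\<close>, \<open>P\<^sub>0\<close> for \<open>P\<^sub>0\<close>, \<open>P\<^sub>1\<close>, \<open>Q\<^sub>0\<close>, \<open>Q\<^sub>1\<close>.
\<close>

lemma simple_rate_bounds:
  fixes P0 P1 Q0 Q1 :: real
  assumes pos: "0 < P0" "0 < P1" "0 < Q0" "0 < Q1" and "P0 + Q0 \<le> 1" "P1 + Q1 \<le> 1" and "Q0 \<le> Q1"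
  shows "P0 \<le> P1 \<Longrightarrow> (Q1 * P0 + Q0 * (1 - P1)) / (1 - (P1 - P0)) \<le> Q1 / (1 - (Q0 - Q1))"
    and "P1 \<le> P0 \<Longrightarrow> (Q0 + P1 * (Q1 - Q0)) / (1 - (Q1 - Q0) * (P0 - P1)) \<le> Q1 / (1 - (Q0 - Q1))"
proof -
  \<comment> \<open>In both claims, clearing denominators leaves exactly the expression in
    \<open>key\<close> as the difference of the two sides.\<close>
  have "P0 * Q1 \<le> (1 - Q0) * (1 - P1)"
    using assms by (intro mult_mono) auto
  then have key: "0 \<le> (Q1 - Q0) * ((1 - Q0) * (1 - P1) - P0 * Q1)"
    using assms by simp
  have Qden: "0 < 1 - (Q0 - Q1)" using assms by linarith
  show "(Q1 * P0 + Q0 * (1 - P1)) / (1 - (P1 - P0)) \<le> Q1 / (1 - (Q0 - Q1))" if "P0 \<le> P1"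
  proof -
    have "0 < 1 - (P1 - P0)" using assms by linarith
    moreover have "(Q1 * P0 + Q0 * (1 - P1)) * (1 - (Q0 - Q1)) \<le> Q1 * (1 - (P1 - P0))"
      using key by (simp add: algebra_simps)
    ultimately show ?thesis
      using Qden by (simp add: divide_simps mult.commute)
  qed
  show "(Q0 + P1 * (Q1 - Q0)) / (1 - (Q1 - Q0) * (P0 - P1)) \<le> Q1 / (1 - (Q0 - Q1))" if "P1 \<le> P0"
  proof -
    have "(Q1 - Q0) * (P0 - P1) \<le> (Q1 - Q0) * 1"
      using assms by (intro mult_left_mono) auto
    also have "\<dots> < 1" using assms by simp
    finally have "0 < 1 - (Q1 - Q0) * (P0 - P1)" by simp
    moreover have "(Q0 + P1 * (Q1 - Q0)) * (1 - (Q0 - Q1)) \<le> Q1 * (1 - (Q1 - Q0) * (P0 - P1))"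
      using key by (simp add: algebra_simps)
    ultimately show ?thesis
      using Qden by (simp add: divide_simps mult.commute)
  qed
qed

section \<open>Rates, letter probabilities and correctors\<close>

locale positive_rates =
  fixes p :: "bool \<Rightarrow> bool \<Rightarrow> real"
  assumes p01: "\<And>a b. 0 < p a b \<and> p a b < 1"
begin

lemma p_all_le: "p_all p \<le> p a b"
  unfolding p_all_def by (cases a; cases b) auto

lemma le_one_minus_q_all: "p a b \<le> 1 - q_all p"
  unfolding q_all_def by (cases a; cases b) auto

lemma p_all_pos: "0 < p_all p"
  unfolding p_all_def using p01 by auto

lemma q_all_pos: "0 < q_all p"
  unfolding q_all_def using p01 by auto

lemma r_all_bounds: "0 \<le> r_all p" "r_all p < 1"
  using p_all_le[of True True] le_one_minus_q_all[of True True] p_all_pos q_all_pos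
  unfolding r_all_def by linarith+

lemma p_sup_le: "p_sup p i a \<le> par_at p i a y"
  by (cases y) (auto simp: p_sup_def)

lemma le_one_minus_q_sup: "par_at p i a y \<le> 1 - q_sup p i a"
  by (cases y) (auto simp: q_sup_def)

lemma p_all_le_p_sup: "p_all p \<le> p_sup p i a"
  by (auto simp: p_sup_def par_at_def p_all_le)

lemma q_all_le_q_sup: "q_all p \<le> q_sup p i a"
  using le_one_minus_q_all[of a False] le_one_minus_q_all[of a True]
    le_one_minus_q_all[of False a] le_one_minus_q_all[of True a]
  by (auto simp: q_sup_def par_at_def max_def)

lemma p_sup_pos: "0 < p_sup p i a"
  using p_all_le_p_sup[of i a] p_all_pos by linarith

lemma q_sup_pos: "0 < q_sup p i a"
  using q_all_le_q_sup[of i a] q_all_pos by linarith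

lemma r_sup_bounds: "0 \<le> r_sup p i a" "r_sup p i a < 1" "r_sup p i a \<le> r_all p"
  using p_sup_le[of i a True] le_one_minus_q_sup[of i a True] p_sup_pos[of i a] q_sup_pos[of i a]
    p_all_le_p_sup[of i a] q_all_le_q_sup[of i a]
  unfolding r_sup_def r_all_def by linarith+

lemma P_sup_pos: "0 < P_sup p i a"
  unfolding P_sup_def
  using r_all_bounds r_sup_bounds[of i a] p_sup_pos[of i a] p_sup_pos[of "\<not> i" a] p_all_pos
  by (intro add_nonneg_pos[THEN add_pos_nonneg] mult_nonneg_nonneg mult_pos_pos) auto

lemma Q_sup_pos: "0 < Q_sup p i a"
  unfolding Q_sup_def
  using r_all_bounds r_sup_bounds[of i a] q_sup_pos[of i a] q_sup_pos[of "\<not> i" a] q_all_pos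
  by (intro add_nonneg_pos[THEN add_pos_nonneg] mult_nonneg_nonneg mult_pos_pos) auto

text \<open>The missing mass \<open>r_sup p i a * r_sup p (\<not> i) a\<close> is the event that the
  scan stops at site 0 and that the value there hinges on the letter beyond the border.\<close>

lemma P_sup_add_Q_sup: "P_sup p i a + Q_sup p i a \<le> 1"
proof -
  have "P_sup p i a + Q_sup p i a = 1 - r_sup p i a * r_sup p (\<not> i) a"
    unfolding P_sup_def Q_sup_def by (simp add: r_sup_def r_all_def algebra_simps)
  then show ?thesis using r_sup_bounds by simp
qed

lemma gamma_sup_le:
  "r_sup p i False \<le> r_sup p i True \<Longrightarrow>
    gamma_sup p i \<le> Q_sup p i True / (1 - (Q_sup p i False - Q_sup p i True))"
  "\<not> r_sup p i False \<le> r_sup p i True \<Longrightarrow>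
    gamma_sup p i \<le> P_sup p i False / (1 - (P_sup p i True - P_sup p i False))"
  using simple_rate_bounds[of "P_sup p i False" "P_sup p i True" "Q_sup p i False" "Q_sup p i True"]
    simple_rate_bounds[of "Q_sup p i True" "Q_sup p i False" "P_sup p i True" "P_sup p i False"]
    P_sup_pos[of i] Q_sup_pos[of i] P_sup_add_Q_sup[of i]
  by (auto simp: gamma_sup_def Let_def add.commute mult.commute)

text \<open>
  The scan at the left border (\<open>i\<close> is \<open>False\<close>) or at the right border (\<open>i\<close> is \<open>True\<close>) next to the letter \<open>a\<close>:
  site \<open>0\<close> is updated from known letters, with rate \<open>c\<close>; site \<open>1\<close> sees \<open>a\<close> and an unknown letter; the
  others see two unknown letters.
\<close>

definition scan_lo :: "bool \<Rightarrow> bool \<Rightarrow> real \<Rightarrow> nat \<Rightarrow> real" where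
  "scan_lo i a c j = (if j = 0 then c else if j = 1 then p_sup p i a else p_all p)"

definition scan_hi :: "bool \<Rightarrow> bool \<Rightarrow> real \<Rightarrow> nat \<Rightarrow> real" where
  "scan_hi i a c j = (if j = 0 then c else if j = 1 then 1 - q_sup p i a else 1 - q_all p)"

lemma scan_thresholds:
  assumes "0 \<le> c" "c \<le> 1"
  shows "0 \<le> scan_lo i a c j \<and> scan_lo i a c j \<le> scan_hi i a c j \<and> scan_hi i a c j \<le> 1"
  using assms p_all_pos q_all_pos r_all_bounds p_sup_pos[of i a] q_sup_pos[of i a] r_sup_bounds[of i a]
  by (auto simp: scan_lo_def scan_hi_def r_all_def r_sup_def)

text \<open>The average of the two rates when the letter with the smaller rate has frequency
  \<open>gamma_sup p i\<close>, written as in the ergodicity condition.\<close>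

definition mean_rate :: "bool \<Rightarrow> real" where
  "mean_rate i = min (r_sup p i False) (r_sup p i True)
     + (1 - gamma_sup p i) * \<bar>r_sup p i False - r_sup p i True\<bar>"

text \<open>The expectation of \<open>k\<close> in a scan up to \<open>K\<close> is \<open>(1 - r\<^sub>a) * mean_shift K\<close>, and \<open>mean_shift K\<close> tends to \<open>1 / r\<close>.\<close>

definition mean_shift :: "nat \<Rightarrow> real" where
  "mean_shift K = (\<Sum>i<K. (1 - r_all p) ^ i)"

lemma mean_shift_nonneg: "0 \<le> mean_shift K"
  unfolding mean_shift_def using r_all_bounds by (intro sum_nonneg) auto

text \<open>By \<open>scan_letter\<close>, \<open>P\<close> is affine in \<open>c\<close> with slope
  \<open>r_sup p i a\<close>. The letter \<open>y\<close> beyond the border is arbitrary, so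
  \<open>c\<close> is only known to lie between \<open>p_sup p (\<not> i) a\<close> and
  \<open>1 - q_sup p (\<not> i) a\<close>.\<close>

lemma letter_prob_bounds:
  assumes "2 \<le> K" and c: "c = par_at p (\<not> i) a y"
  defines "P \<equiv> \<Sum>k\<le>K. scan_prob (scan_lo i a c) (scan_hi i a c) K k True"
  shows "P_sup p i a \<le> P" "P \<le> 1 - Q_sup p i a"
proof -
  have P: "P = c * r_sup p i a + p_sup p i a * r_all p + (1 - r_sup p i a) * p_all p"
    unfolding P_def
    by (subst scan_letter[OF assms(1), where l = "p_all p" and h = "1 - q_all p"])
      (auto simp: scan_lo_def scan_hi_def r_sup_def r_all_def algebra_simps)
  have "r_sup p i a * p_sup p (\<not> i) a \<le> r_sup p i a * c"
    unfolding c using r_sup_bounds by (intro mult_left_mono p_sup_le)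
  then show "P_sup p i a \<le> P"
    unfolding P P_sup_def by (simp add: mult.commute)
  have "r_sup p i a * c \<le> r_sup p i a * (1 - q_sup p (\<not> i) a)"
    unfolding c using r_sup_bounds by (intro mult_left_mono le_one_minus_q_sup)
  moreover have "p_sup p i a * r_all p + (1 - r_sup p i a) * p_all p
      = (1 - r_sup p i a) - r_all p * q_sup p i a - (1 - r_sup p i a) * q_all p"
    by (simp add: r_sup_def r_all_def algebra_simps)
  ultimately show "P \<le> 1 - Q_sup p i a"
    unfolding P Q_sup_def by (simp add: algebra_simps)
qed

text \<open>Adding \<open>H\<close> of the border letter to the length makes the drift bound the
  same for both letters, with \<open>r_sup p i a\<close> replaced by
  \<open>mean_rate i\<close>.\<close>

lemma corrector_exists:
  assumes "2 \<le> K"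
  obtains H :: "bool \<Rightarrow> real" where
    "\<And>a c y. c = par_at p (\<not> i) a y \<Longrightarrow>
      (\<Sum>k\<le>K. \<Sum>x\<in>UNIV. scan_prob (scan_lo i a c) (scan_hi i a c) K k x * (H x - H a - real k))
       \<le> - mean_shift K * (1 - mean_rate i)"
proof -
  let ?P = "P_sup p i" and ?Q = "Q_sup p i" and ?r = "r_sup p i"
  define dP where "dP = 1 - (?P True - ?P False)"
  define dQ where "dQ = 1 - (?Q False - ?Q True)"
  have d: "0 < dP" "0 < dQ"
    using P_sup_pos[of i] Q_sup_pos[of i] P_sup_add_Q_sup[of i] unfolding dP_def dQ_def
    by (smt (verit))+
  define S where "S = mean_shift K"
  have S: "0 \<le> S" unfolding S_def by (rule mean_shift_nonneg)
  \<comment> \<open>Only the difference of the two values of \<open>H\<close> matters. It is chosen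
    so that the worst-case drifts from letter 0 and from letter 1 coincide.\<close>
  define H where "H x = (if x then S * (?r True - ?r False) / (if ?r False \<le> ?r True then dQ else dP) else 0)"
    for x
  show ?thesis
  proof (rule that)
    fix a c y assume c: "c = par_at p (\<not> i) a y"
    let ?w = "scan_prob (scan_lo i a c) (scan_hi i a c) K"
    define Pr where "Pr = (\<Sum>k\<le>K. ?w k True)"
    have Pr: "?P a \<le> Pr" "Pr \<le> 1 - ?Q a"
      unfolding Pr_def using letter_prob_bounds[OF assms c] by auto
    have mass: "(\<Sum>k\<le>K. ?w k False) = 1 - Pr"
      using scan_mass[of "scan_lo i a c" "scan_hi i a c" K] by (simp add: Pr_def scan_lo_def scan_hi_def)
    have prod: "(\<Prod>j\<le>Suc n. 1 - (scan_hi i a c j - scan_lo i a c j)) = (1 - ?r a) * (1 - r_all p) ^ n" for n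
    proof (induction n)
      case 0
      show ?case by (simp add: scan_hi_def scan_lo_def r_sup_def)
    next
      case (Suc n)
      show ?case
        by (subst prod.atMost_Suc, subst Suc.IH) (simp add: scan_hi_def scan_lo_def r_all_def algebra_simps)
    qed
    have mean: "(\<Sum>k\<le>K. ?w k True * real k) + (\<Sum>k\<le>K. ?w k False * real k) = (1 - ?r a) * S"
      unfolding scan_mean prod S_def mean_shift_def by (simp add: sum_distrib_left)
    have "(\<Sum>k\<le>K. \<Sum>x\<in>UNIV. ?w k x * (H x - H a - real k))
      = Pr * (H True - H a) + (1 - Pr) * (H False - H a) - (1 - ?r a) * S"
    proof -
      have "(\<Sum>k\<le>K. ?w k x * (H x - H a - real k))
          = (\<Sum>k\<le>K. ?w k x) * (H x - H a) - (\<Sum>k\<le>K. ?w k x * real k)" for x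
        by (simp only: right_diff_distrib[of _ "H x - H a"] sum_subtractf sum_distrib_right)
      then show ?thesis
        unfolding mean[symmetric] using mass by (simp add: UNIV_bool sum.distrib Pr_def)
    qed
    also have "\<dots> = S * ?r a + H True * (Pr - of_bool a) - S"
    proof -
      have "H False = 0" by (simp add: H_def)
      then show ?thesis by (cases a) (simp_all add: algebra_simps)
    qed
    also have "\<dots> \<le> S * mean_rate i - S"
    \<comment> \<open>The sign of \<open>H True\<close> decides which bound on \<open>Pr\<close> is
      the worst case: the upper one when letter 1 has the larger rate, the lower one
      otherwise.\<close>
    proof (cases "?r False \<le> ?r True")
      case True
      define g where "g = ?Q True / dQ"
      define D where "D = S * (?r True - ?r False)"
      have D: "0 \<le> D" using S True by (simp add: D_def)
      have H: "H True = D / dQ" using True by (simp add: H_def D_def)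
      have g1: "(1 - ?Q False) / dQ = 1 - g"
        using d by (simp add: g_def field_simps) (simp add: dQ_def)
      have step: "H True * (Pr - of_bool a) + S * ?r a \<le> S * ?r False + D * (1 - g)"
      proof (cases a)
        case False
        have "D / dQ * Pr \<le> D / dQ * (1 - ?Q False)"
          using Pr False D d by (intro mult_left_mono) auto
        also have "\<dots> = D * (1 - g)" by (simp add: g1[symmetric])
        finally show ?thesis using False by (simp add: H)
      next
        case a: True
        have "D / dQ * (Pr - 1) \<le> D / dQ * (- ?Q True)"
          using Pr a D d by (intro mult_left_mono) auto
        also have "\<dots> = - D * g" by (simp add: g_def)
        finally show ?thesis using a by (simp add: H) (simp add: D_def algebra_simps)
      qed
      have "gamma_sup p i \<le> g" using gamma_sup_le(1)[OF True] by (simp add: g_def dQ_def)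
      then have "D * (1 - g) \<le> D * (1 - gamma_sup p i)" using D by (intro mult_left_mono) auto
      moreover have "S * mean_rate i = S * ?r False + D * (1 - gamma_sup p i)"
        using True by (simp add: mean_rate_def D_def algebra_simps)
      ultimately show ?thesis using step by linarith
    next
      case False
      define g where "g = ?P False / dP"
      define D where "D = S * (?r False - ?r True)"
      have D: "0 \<le> D" using S False by (simp add: D_def)
      have H: "H True = - (D / dP)" using False by (simp add: H_def D_def minus_divide_left algebra_simps)
      have g1: "(1 - ?P True) / dP = 1 - g"
        using d by (simp add: g_def field_simps) (simp add: dP_def)
      have step: "H True * (Pr - of_bool a) + S * ?r a \<le> S * ?r True + D * (1 - g)"
      proof (cases a)
        case True
        have "D / dP * (1 - Pr) \<le> D / dP * (1 - ?P True)"
          using Pr True D d by (intro mult_left_mono) auto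
        also have "\<dots> = D * (1 - g)" by (simp add: g1[symmetric])
        finally have "D / dP * (1 - Pr) \<le> D * (1 - g)" .
        moreover have "H True * (Pr - 1) = D / dP * (1 - Pr)"
          unfolding H minus_mult_left[symmetric] minus_mult_right by simp
        ultimately show ?thesis using True by simp
      next
        case a: False
        have "D / dP * ?P False \<le> D / dP * Pr"
          using Pr a D d by (intro mult_left_mono) auto
        moreover have "D / dP * ?P False = D * g" by (simp add: g_def)
        ultimately show ?thesis using a by (simp add: H) (simp add: D_def algebra_simps)
      qed
      have "gamma_sup p i \<le> g" using gamma_sup_le(2)[OF False] by (simp add: g_def dP_def)
      then have "D * (1 - g) \<le> D * (1 - gamma_sup p i)" using D by (intro mult_left_mono) auto
      moreover have "S * mean_rate i = S * ?r True + D * (1 - gamma_sup p i)"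
        using False by (simp add: mean_rate_def D_def algebra_simps)
      ultimately show ?thesis using step by linarith
    qed
    finally show "(\<Sum>k\<le>K. \<Sum>x\<in>UNIV. ?w k x * (H x - H a - real k)) \<le> - mean_shift K * (1 - mean_rate i)"
      by (simp add: S_def algebra_simps)
  qed
qed

text \<open>The condition says \<open>r_all p < M\<close>, and \<open>mean_shift K\<close> increases
  to \<open>1 / r_all p\<close>, or is \<open>K\<close> itself if \<open>r_all p = 0\<close>. The
  threshold 1 is the growth of the interval per step before the scans shorten it.\<close>

lemma large_mean_shift:
  assumes "2 - r_all p > mean_rate False + mean_rate True"
  obtains K where "2 \<le> K" "1 < mean_shift K * ((1 - mean_rate False) + (1 - mean_rate True))"
proof -
  define M where "M = (1 - mean_rate False) + (1 - mean_rate True)"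
  have M: "r_all p < M" using assms by (simp add: M_def)
  then have "0 < M" using r_all_bounds by linarith
  have "\<exists>K. 1 < mean_shift K * M"
  proof (cases "r_all p = 0")
    case True
    obtain K where "1 < real K * M" using reals_Archimedean3[OF \<open>0 < M\<close>] by blast
    then show ?thesis by (auto simp: mean_shift_def True)
  next
    case False
    then have r: "0 < r_all p" using r_all_bounds by simp
    have "mean_shift \<longlonglongrightarrow> 1 / r_all p"
      using geometric_sums[of "1 - r_all p"] r r_all_bounds by (simp add: sums_def mean_shift_def[abs_def])
    then have "(\<lambda>K. mean_shift K * M) \<longlonglongrightarrow> 1 / r_all p * M" by (intro tendsto_mult_right)
    moreover have "1 < 1 / r_all p * M" using r M by simp
    ultimately have "\<forall>\<^sub>F K in sequentially. 1 < mean_shift K * M" by (rule order_tendstoD)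
    then show ?thesis by (auto simp: eventually_sequentially)
  qed
  then obtain K where K: "1 < mean_shift K * M" by blast
  have "mean_shift K \<le> mean_shift (K + 2)"
    unfolding mean_shift_def using r_all_bounds by (intro sum_mono2) auto
  then have "mean_shift K * M \<le> mean_shift (K + 2) * M" using \<open>0 < M\<close> by simp
  with K show ?thesis by (intro that[of "K + 2"]) (auto simp: M_def)
qed

end

section \<open>Contraction of the interval of disagreement\<close>

definition agree_off :: "int \<Rightarrow> int \<Rightarrow> config \<Rightarrow> config \<Rightarrow> bool" where
  "agree_off L R \<eta> \<xi> \<longleftrightarrow> (\<forall>i. i < L \<or> R < i \<longrightarrow> \<eta> i = \<xi> i)"

lemma exp_le_quadratic:
  fixes x :: real
  assumes "\<bar>x\<bar> \<le> 1"
  shows "exp x \<le> 1 + x + x\<^sup>2"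
proof (cases "0 \<le> x")
  case True
  then show ?thesis using assms by (intro exp_bound) auto
next
  case False
  define y where "y = - x"
  have y: "0 \<le> y" using False by (simp add: y_def)
  \<comment> \<open>For \<open>x = - y\<close> the claim says that
    \<open>(1 - y + y\<^sup>2) * exp y\<close> is at least 1, for which the quadratic Taylor bound
    on \<open>exp y\<close> suffices.\<close>
  have "1 \<le> 1 + y\<^sup>2 / 2 + y ^ 3 / 2 + y ^ 4 / 2" using y by simp
  also have "\<dots> = (1 - y + y\<^sup>2) * (1 + y + y\<^sup>2 / 2)"
    by (simp add: field_simps power2_eq_square power3_eq_cube power4_eq_xxxx)
  also have "\<dots> \<le> (1 - y + y\<^sup>2) * exp y"
  proof (intro mult_left_mono exp_lower_Taylor_quadratic y)
    have "y \<le> 1" using assms by (simp add: y_def)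
    then show "0 \<le> 1 - y + y\<^sup>2" by (simp add: add_nonneg_nonneg)
  qed
  finally have "exp (- y) \<le> 1 - y + y\<^sup>2"
    by (simp add: exp_minus field_simps)
  then show ?thesis by (simp add: y_def)
qed

text \<open>The product weights model two independent scans. A second-order bound on the exponential
  leaves the mean as linear term and \<open>Z\<close> as bound for the quadratic one.\<close>

lemma exp_moment_bound:
  fixes w :: "'a \<Rightarrow> real" and v :: "'b \<Rightarrow> real" and f :: "'a \<Rightarrow> real" and g :: "'b \<Rightarrow> real"
  assumes w: "\<And>a. a \<in> A \<Longrightarrow> 0 \<le> w a" "sum w A = 1"
    and v: "\<And>b. b \<in> B \<Longrightarrow> 0 \<le> v b" "sum v B = 1"
    and Z: "\<And>a b. a \<in> A \<Longrightarrow> b \<in> B \<Longrightarrow> \<bar>c + f a + g b\<bar> \<le> Z"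
    and mean: "c + (\<Sum>a\<in>A. w a * f a) + (\<Sum>b\<in>B. v b * g b) \<le> - e"
    and \<theta>: "0 \<le> \<theta>" "\<theta> * Z \<le> 1"
  shows "(\<Sum>a\<in>A. \<Sum>b\<in>B. w a * v b * exp (\<theta> * (c + f a + g b))) \<le> 1 - \<theta> * e + (\<theta> * Z)\<^sup>2"
proof -
  have "(\<Sum>a\<in>A. \<Sum>b\<in>B. w a * v b * exp (\<theta> * (c + f a + g b)))
      \<le> (\<Sum>a\<in>A. \<Sum>b\<in>B. w a * v b * (1 + \<theta> * (c + f a + g b) + (\<theta> * Z)\<^sup>2))"
  proof (intro sum_mono mult_left_mono mult_nonneg_nonneg w v)
    fix a b assume ab: "a \<in> A" "b \<in> B"
    have "\<bar>\<theta> * (c + f a + g b)\<bar> \<le> \<theta> * Z"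
      using Z[OF ab] \<theta> by (simp add: abs_mult mult_left_mono)
    moreover from this have "(\<theta> * (c + f a + g b))\<^sup>2 \<le> (\<theta> * Z)\<^sup>2"
      by (rule power2_le_iff_abs_le[THEN iffD2, rotated]) (use \<open>\<bar>\<theta> * (c + f a + g b)\<bar> \<le> \<theta> * Z\<close> in linarith)
    ultimately show "exp (\<theta> * (c + f a + g b)) \<le> 1 + \<theta> * (c + f a + g b) + (\<theta> * Z)\<^sup>2"
      using exp_le_quadratic[of "\<theta> * (c + f a + g b)"] \<theta> by linarith
  qed
  also have "\<dots> = (\<Sum>a\<in>A. w a * (\<Sum>b\<in>B. v b * (1 + \<theta> * c + (\<theta> * Z)\<^sup>2 + \<theta> * f a) + \<theta> * (v b * g b)))"
    by (simp add: sum_distrib_left algebra_simps)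
  also have "\<dots> = (\<Sum>a\<in>A. w a * (1 + \<theta> * c + (\<theta> * Z)\<^sup>2 + \<theta> * (\<Sum>b\<in>B. v b * g b)) + \<theta> * (w a * f a))"
  proof (rule sum.cong[OF refl])
    fix a
    have "(\<Sum>b\<in>B. v b * (1 + \<theta> * c + (\<theta> * Z)\<^sup>2 + \<theta> * f a) + \<theta> * (v b * g b))
        = 1 + \<theta> * c + (\<theta> * Z)\<^sup>2 + \<theta> * f a + \<theta> * (\<Sum>b\<in>B. v b * g b)"
      by (simp only: sum.distrib sum_distrib_right[symmetric] sum_distrib_left[symmetric] v(2) mult_1)
    then show "w a * (\<Sum>b\<in>B. v b * (1 + \<theta> * c + (\<theta> * Z)\<^sup>2 + \<theta> * f a) + \<theta> * (v b * g b))
        = w a * (1 + \<theta> * c + (\<theta> * Z)\<^sup>2 + \<theta> * (\<Sum>b\<in>B. v b * g b)) + \<theta> * (w a * f a)"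
      by (simp add: algebra_simps)
  qed
  also have "\<dots> = 1 + (\<theta> * Z)\<^sup>2 + \<theta> * (c + (\<Sum>a\<in>A. w a * f a) + (\<Sum>b\<in>B. v b * g b))"
    by (simp only: sum.distrib sum_distrib_right[symmetric] sum_distrib_left[symmetric] w(2) mult_1)
      (simp add: algebra_simps)
  also have "\<dots> \<le> 1 + (\<theta> * Z)\<^sup>2 + \<theta> * - e"
    using mean \<theta> by (intro add_left_mono mult_left_mono) auto
  finally show ?thesis by simp
qed

text \<open>Independence of the two scans: as their sites are disjoint, the two conditions form one
  cylinder.\<close>

lemma measure_disjoint_cylinders:
  fixes s t :: "nat \<Rightarrow> int"
  assumes inj: "inj_on s {..K}" "inj_on t {..K}" and disj: "s ` {..K} \<inter> t ` {..K} = {}"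
    and sets: "\<And>j. A j \<in> sets borel" "\<And>j. B j \<in> sets borel"
  shows "{U. (\<forall>j\<le>K. U (s j) \<in> A j) \<and> (\<forall>j\<le>K. U (t j) \<in> B j)} \<in> sets noise_field"
    and "measure noise_field {U. (\<forall>j\<le>K. U (s j) \<in> A j) \<and> (\<forall>j\<le>K. U (t j) \<in> B j)}
      = (\<Prod>j\<le>K. measure noise (A j)) * (\<Prod>j\<le>K. measure noise (B j))"
proof -
  define E where "E i = (if i \<in> s ` {..K} then A (inv_into {..K} s i) else B (inv_into {..K} t i))" for i
  let ?J = "s ` {..K} \<union> t ` {..K}"
  have Es: "E (s j) = A j" if "j \<le> K" for j
    using that inj by (simp add: E_def)
  have Et: "E (t j) = B j" if "j \<le> K" for j
    using that inj disj by (auto simp: E_def)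
  have E: "E i \<in> sets borel" for i
    using sets by (simp add: E_def)
  have eq: "{U. (\<forall>j\<le>K. U (s j) \<in> A j) \<and> (\<forall>j\<le>K. U (t j) \<in> B j)} = {U. \<forall>i\<in>?J. U i \<in> E i}"
    using Es Et by (auto simp: ball_Un)
  show "{U. (\<forall>j\<le>K. U (s j) \<in> A j) \<and> (\<forall>j\<le>K. U (t j) \<in> B j)} \<in> sets noise_field"
    unfolding eq using E by (intro cylinder_sets) auto
  have "measure noise_field {U. \<forall>i\<in>?J. U i \<in> E i} = (\<Prod>i\<in>?J. measure noise (E i))"
    using E by (intro measure_cylinder) auto
  also have "\<dots> = (\<Prod>i\<in>s ` {..K}. measure noise (E i)) * (\<Prod>i\<in>t ` {..K}. measure noise (E i))"
    using disj by (intro prod.union_disjoint) auto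
  also have "\<dots> = (\<Prod>j\<le>K. measure noise (A j)) * (\<Prod>j\<le>K. measure noise (B j))"
    using inj by (simp add: prod.reindex Es Et)
  finally show "measure noise_field {U. (\<forall>j\<le>K. U (s j) \<in> A j) \<and> (\<forall>j\<le>K. U (t j) \<in> B j)}
      = (\<Prod>j\<le>K. measure noise (A j)) * (\<Prod>j\<le>K. measure noise (B j))"
    unfolding eq .
qed

section \<open>One step of two coupled configurations\<close>

context positive_rates
begin

text \<open>These thresholds bound the rate over all pairs of letters, so a forced site takes the
  same value in both coupled configurations. The next two lemmas use the sharper thresholds
  available when one letter is known.\<close>

lemma update_known_interior:
  assumes "U i < p_all p \<or> 1 - q_all p \<le> U i"
  shows "update p \<eta> U i \<longleftrightarrow> U i < p_all p"
  using assms p_all_le[of "\<eta> i" "\<eta> (i + 1)"] le_one_minus_q_all[of "\<eta> i" "\<eta> (i + 1)"]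
  unfolding update_def by linarith

lemma update_known_left:
  assumes "U i < p_sup p False (\<eta> i) \<or> 1 - q_sup p False (\<eta> i) \<le> U i"
  shows "update p \<eta> U i \<longleftrightarrow> U i < p_sup p False (\<eta> i)"
  using assms p_sup_le[of False "\<eta> i" "\<eta> (i + 1)"] le_one_minus_q_sup[of False "\<eta> i" "\<eta> (i + 1)"]
  unfolding update_def by (auto simp: par_at_def)

lemma update_known_right:
  assumes "U i < p_sup p True (\<eta> (i + 1)) \<or> 1 - q_sup p True (\<eta> (i + 1)) \<le> U i"
  shows "update p \<eta> U i \<longleftrightarrow> U i < p_sup p True (\<eta> (i + 1))"
  using assms p_sup_le[of True "\<eta> (i + 1)" "\<eta> i"] le_one_minus_q_sup[of True "\<eta> (i + 1)" "\<eta> i"]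
  unfolding update_def by (auto simp: par_at_def)

text \<open>
  Site \<open>j\<close> of the left scan is \<open>L - 2 + j\<close>, and that of the right scan is \<open>R + 1 - j\<close>. The new interval is
  \<open>[L - 1 + k, R - k']\<close> for the outcomes \<open>k\<close> and \<open>k'\<close>.
\<close>

lemma left_scan:
  fixes \<eta> :: config and L :: int
  defines "a \<equiv> \<eta> (L - 1)" and "c \<equiv> p (\<eta> (L - 2)) (\<eta> (L - 1))"
  assumes U: "\<And>j. j \<le> K \<Longrightarrow> U (L - 2 + int j) \<in> scan_set (scan_lo False a c) (scan_hi False a c) k x j"
    and "k \<le> K"
  shows "update p \<eta> U (L - 2 + int k) = x"
    and "agree_off L R \<eta> \<xi> \<Longrightarrow> i < L - 1 + int k \<Longrightarrow> update p \<eta> U i = update p \<xi> U i"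
proof -
  have known: "U (L - 2 + int j) < scan_lo False a c j \<or> scan_hi False a c j \<le> U (L - 2 + int j)"
    if "j \<le> k" for j
    using U[of j] that \<open>k \<le> K\<close> by (auto simp: scan_set_def split: if_splits)
  have val: "update p \<eta> U (L - 2 + int j) \<longleftrightarrow> U (L - 2 + int j) < scan_lo False a c j"
    if "j \<le> k" for j
  proof -
    consider "j = 0" | "j = 1" | "2 \<le> j" by linarith
    then show ?thesis
    proof cases
      case 1 then show ?thesis by (simp add: update_def scan_lo_def c_def)
    next
      case 2 then show ?thesis
        using known[OF that] update_known_left[of U "L - 1" \<eta>] by (simp add: scan_lo_def scan_hi_def a_def)
    next
      case 3 then show ?thesis
        using known[OF that] update_known_interior[of U "L - 2 + int j" \<eta>]
        by (simp add: scan_lo_def scan_hi_def)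
    qed
  qed
  \<comment> \<open>This site lies just outside the new interval, so \<open>x\<close> is the new
    border letter.\<close>
  show "update p \<eta> U (L - 2 + int k) = x"
    using val[of k] known[of k] U[of k] \<open>k \<le> K\<close> scan_thresholds[of c False a k] p01[of "\<eta> (L - 2)" "\<eta> (L - 1)"]
    by (cases x) (auto simp: scan_set_def c_def)
  show "update p \<eta> U i = update p \<xi> U i" if "agree_off L R \<eta> \<xi>" "i < L - 1 + int k"
  proof -
    consider "i \<le> L - 2" | "i = L - 1" | "L \<le> i" by linarith
    then show ?thesis
    proof cases
      case 1 then show ?thesis using that by (simp add: update_def agree_off_def)
    next
      case 2
      then have "1 \<le> k" "\<xi> i = \<eta> i" using that by (auto simp: agree_off_def)
      then show ?thesis
        using 2 known[of 1] update_known_left[of U i \<eta>] update_known_left[of U i \<xi>]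
        by (simp add: scan_lo_def scan_hi_def a_def)
    next
      case 3
      define j where "j = nat (i - (L - 2))"
      have j: "i = L - 2 + int j" "2 \<le> j" "j \<le> k" using 3 that by (auto simp: j_def)
      then show ?thesis
        using known[of j] update_known_interior[of U i \<eta>] update_known_interior[of U i \<xi>]
        by (simp add: scan_lo_def scan_hi_def)
    qed
  qed
qed

text \<open>Not a literal mirror image of the left scan: site \<open>i\<close> reads
  \<open>i\<close> and \<open>i + 1\<close>, so the sites that see one known border letter are
  \<open>L - 1\<close> on the left but \<open>R\<close> on the right.\<close>

lemma right_scan:
  fixes \<eta> :: config and R :: int
  defines "b \<equiv> \<eta> (R + 1)" and "c \<equiv> p (\<eta> (R + 1)) (\<eta> (R + 2))"
  assumes U: "\<And>j. j \<le> K \<Longrightarrow> U (R + 1 - int j) \<in> scan_set (scan_lo True b c) (scan_hi True b c) k x j"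
    and "k \<le> K"
  shows "update p \<eta> U (R + 1 - int k) = x"
    and "agree_off L R \<eta> \<xi> \<Longrightarrow> R - int k < i \<Longrightarrow> update p \<eta> U i = update p \<xi> U i"
proof -
  have known: "U (R + 1 - int j) < scan_lo True b c j \<or> scan_hi True b c j \<le> U (R + 1 - int j)"
    if "j \<le> k" for j
    using U[of j] that \<open>k \<le> K\<close> by (auto simp: scan_set_def split: if_splits)
  have val: "update p \<eta> U (R + 1 - int j) \<longleftrightarrow> U (R + 1 - int j) < scan_lo True b c j"
    if "j \<le> k" for j
  proof -
    consider "j = 0" | "j = 1" | "2 \<le> j" by linarith
    then show ?thesis
    proof cases
      case 1 then show ?thesis by (simp add: update_def scan_lo_def c_def add.assoc)
    next
      case 2 then show ?thesis
        using known[OF that] update_known_right[of U R \<eta>] by (simp add: scan_lo_def scan_hi_def b_def)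
    next
      case 3 then show ?thesis
        using known[OF that] update_known_interior[of U "R + 1 - int j" \<eta>]
        by (simp add: scan_lo_def scan_hi_def)
    qed
  qed
  show "update p \<eta> U (R + 1 - int k) = x"
    using val[of k] known[of k] U[of k] \<open>k \<le> K\<close> scan_thresholds[of c True b k] p01[of "\<eta> (R + 1)" "\<eta> (R + 2)"]
    by (cases x) (auto simp: scan_set_def c_def)
  show "update p \<eta> U i = update p \<xi> U i" if "agree_off L R \<eta> \<xi>" "R - int k < i"
  proof -
    consider "R + 1 \<le> i" | "i = R" | "i < R" by linarith
    then show ?thesis
    proof cases
      case 1 then show ?thesis using that by (simp add: update_def agree_off_def)
    next
      case 2
      then have "1 \<le> k" "\<xi> (i + 1) = \<eta> (i + 1)" using that by (auto simp: agree_off_def)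
      then show ?thesis
        using 2 known[of 1] update_known_right[of U i \<eta>] update_known_right[of U i \<xi>]
        by (simp add: scan_lo_def scan_hi_def b_def)
    next
      case 3
      define j where "j = nat (R + 1 - i)"
      have j: "i = R + 1 - int j" "2 \<le> j" "j \<le> k" using 3 that by (auto simp: j_def)
      then show ?thesis
        using known[of j] update_known_interior[of U i \<eta>] update_known_interior[of U i \<xi>]
        by (simp add: scan_lo_def scan_hi_def)
    qed
  qed
qed

lemma integral_pca_kernel':
  fixes f :: "config \<Rightarrow> real"
  assumes "f \<in> borel_measurable configs"
  shows "(\<integral>x. f x \<partial>pca_kernel p \<eta>) = (\<integral>U. f (update p \<eta> U) \<partial>noise_field)"
  by (rule integral_pca_kernel[OF _ assms]) (use p01 less_imp_le in blast)

text \<open>Coupling inequality: both integrals become integrals over the same noise.\<close>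

lemma kernel_difference_bound:
  fixes f :: "config \<Rightarrow> real"
  assumes f: "f \<in> borel_measurable configs" and B: "\<And>x. \<bar>f x\<bar> \<le> B"
    and G: "integrable noise_field G"
    and le: "\<And>U. \<bar>f (update p \<eta> U) - f (update p \<xi> U)\<bar> \<le> G U"
  shows "\<bar>(\<integral>x. f x \<partial>pca_kernel p \<eta>) - (\<integral>x. f x \<partial>pca_kernel p \<xi>)\<bar> \<le> (\<integral>U. G U \<partial>noise_field)"
proof -
  interpret F: prob_space noise_field by (rule prob_space_noise_field)
  have int: "integrable noise_field (\<lambda>U. f (update p \<zeta> U))" for \<zeta>
    using B measurable_compose[OF update_measurable f] by (intro F.integrable_const_bound[of _ B]) auto
  have "(\<integral>x. f x \<partial>pca_kernel p \<eta>) - (\<integral>x. f x \<partial>pca_kernel p \<xi>)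
      = (\<integral>U. f (update p \<eta> U) - f (update p \<xi> U) \<partial>noise_field)"
    using int by (simp add: integral_pca_kernel'[OF f])
  also have "\<bar>\<dots>\<bar> \<le> (\<integral>U. \<bar>f (update p \<eta> U) - f (update p \<xi> U)\<bar> \<partial>noise_field)"
    by (rule integral_abs_bound)
  also have "\<dots> \<le> (\<integral>U. G U \<partial>noise_field)"
    using int by (intro integral_mono integrable_abs Bochner_Integration.integrable_diff G le) auto
  finally show ?thesis .
qed

text \<open>The border letters are read off the interval, where the two coupled configurations
  agree.\<close>

definition potential :: "real \<Rightarrow> (bool \<Rightarrow> real) \<Rightarrow> (bool \<Rightarrow> real) \<Rightarrow> config \<Rightarrow> int \<Rightarrow> int \<Rightarrow> real" where
  "potential \<theta> H0 H1 \<eta> L R = exp (\<theta> * (of_int (R - L) + H0 (\<eta> (L - 1)) + H1 (\<eta> (R + 1))))"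

text \<open>If the interval is long, the two scans use disjoint sets of sites and are therefore independent.\<close>

lemma long_interval_bound:
  fixes f :: "config \<Rightarrow> real"
  assumes f: "f \<in> borel_measurable configs" and B: "\<And>x. \<bar>f x\<bar> \<le> B"
    and len: "2 * int K \<le> R - L" and agree: "agree_off L R \<eta> \<xi>" and "0 \<le> C"
    and lip: "\<And>\<eta>' \<xi>' L' R'. L' \<le> R' \<Longrightarrow> agree_off L' R' \<eta>' \<xi>' \<Longrightarrow>
      \<bar>f \<eta>' - f \<xi>'\<bar> \<le> C * potential \<theta> H0 H1 \<eta>' L' R'"
  defines "a \<equiv> \<eta> (L - 1)" and "b \<equiv> \<eta> (R + 1)"
  defines "c \<equiv> p (\<eta> (L - 2)) (\<eta> (L - 1))" and "d \<equiv> p (\<eta> (R + 1)) (\<eta> (R + 2))"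
  defines "w \<equiv> \<lambda>(k, x). scan_prob (scan_lo False a c) (scan_hi False a c) K k x"
    and "v \<equiv> \<lambda>(k, x). scan_prob (scan_lo True b d) (scan_hi True b d) K k x"
  shows "\<bar>(\<integral>x. f x \<partial>pca_kernel p \<eta>) - (\<integral>x. f x \<partial>pca_kernel p \<xi>)\<bar> \<le>
    C * potential \<theta> H0 H1 \<eta> L R * (\<Sum>u\<in>{..K} \<times> UNIV. \<Sum>u'\<in>{..K} \<times> UNIV. w u * v u' *
      exp (\<theta> * (1 + (H0 (snd u) - H0 a - real (fst u)) + (H1 (snd u') - H1 b - real (fst u')))))"
proof -
  interpret F: prob_space noise_field by (rule prob_space_noise_field)
  define A where "A = {..K} \<times> (UNIV :: bool set)"
  define e where "e u u' = exp (\<theta> * (1 + (H0 (snd u) - H0 a - real (fst u)) + (H1 (snd u') - H1 b - real (fst u'))))"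
    for u u' :: "nat \<times> bool"
  define V where "V = C * potential \<theta> H0 H1 \<eta> L R"
  have V: "0 \<le> V" using \<open>0 \<le> C\<close> by (simp add: V_def potential_def)
  let ?SL = "\<lambda>u. scan_set (scan_lo False a c) (scan_hi False a c) (fst u) (snd u)"
  let ?SR = "\<lambda>u. scan_set (scan_lo True b d) (scan_hi True b d) (fst u) (snd u)"
  define cyl where "cyl u u' = {U. (\<forall>j\<le>K. U (L - 2 + int j) \<in> ?SL u j) \<and> (\<forall>j\<le>K. U (R + 1 - int j) \<in> ?SR u' j)}"
    for u u'
  have cd: "0 \<le> c" "c \<le> 1" "0 \<le> d" "d \<le> 1"
    unfolding c_def d_def using p01 less_imp_le by blast+
  have cyl: "cyl u u' \<in> sets noise_field" for u u'
    unfolding cyl_def by (rule measure_disjoint_cylinders(1)) (use len in \<open>auto simp: inj_on_def\<close>)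
  have cyl_prob: "measure noise_field (cyl u u') = w u * v u'" if "u \<in> A" "u' \<in> A" for u u'
  proof -
    have "measure noise_field (cyl u u') = (\<Prod>j\<le>K. measure noise (?SL u j)) * (\<Prod>j\<le>K. measure noise (?SR u' j))"
      unfolding cyl_def by (rule measure_disjoint_cylinders(2)) (use len in \<open>auto simp: inj_on_def\<close>)
    also have "\<dots> = w u * v u'"
      using that scan_prob_eq_measure[of "fst u" K "scan_lo False a c" "scan_hi False a c" "snd u", OF _ scan_thresholds[OF cd(1,2)]]
        scan_prob_eq_measure[of "fst u'" K "scan_lo True b d" "scan_hi True b d" "snd u'", OF _ scan_thresholds[OF cd(3,4)]]
      by (auto simp: A_def w_def v_def)
    finally show ?thesis .
  qed
  \<comment> \<open>Splits the noise by the outcomes of both scans; independence turns the integral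
    into the double sum of the claim.\<close>
  define G where "G U = (\<Sum>u\<in>A. \<Sum>u'\<in>A. V * e u u' * indicator (cyl u u') U)" for U
  have ind: "integrable noise_field (indicator (cyl u u') :: _ \<Rightarrow> real)" for u u'
    using cyl by (intro integrable_real_indicator) (auto simp: F.emeasure_eq_measure)
  have G: "integrable noise_field G"
    unfolding G_def using ind by (intro Bochner_Integration.integrable_sum integrable_mult_right)
  have "(\<integral>U. G U \<partial>noise_field) = (\<Sum>u\<in>A. \<Sum>u'\<in>A. V * e u u' * measure noise_field (cyl u u'))"
    unfolding G_def using ind cyl by (simp add: integral_sum)
  also have "\<dots> = V * (\<Sum>u\<in>A. \<Sum>u'\<in>A. w u * v u' * e u u')"
    unfolding sum_distrib_left by (intro sum.cong refl) (simp add: cyl_prob)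
  finally have int_G: "(\<integral>U. G U \<partial>noise_field) = V * (\<Sum>u\<in>A. \<Sum>u'\<in>A. w u * v u' * e u u')" .
  have "\<bar>f (update p \<eta> U) - f (update p \<xi> U)\<bar> \<le> G U" for U
  proof -
    obtain k x where k: "k \<le> K" "\<And>j. j \<le> K \<Longrightarrow> U (L - 2 + int j) \<in> ?SL (k, x) j"
      using scan_outcome_exists[of "scan_lo False a c" "scan_hi False a c" K "\<lambda>j. U (L - 2 + int j)"]
      by (auto simp: scan_lo_def scan_hi_def)
    obtain k' x' where k': "k' \<le> K" "\<And>j. j \<le> K \<Longrightarrow> U (R + 1 - int j) \<in> ?SR (k', x') j"
      using scan_outcome_exists[of "scan_lo True b d" "scan_hi True b d" K "\<lambda>j. U (R + 1 - int j)"]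
      by (auto simp: scan_lo_def scan_hi_def)
    note left = left_scan[of K U L \<eta> k x, folded a_def c_def, OF k(2)[simplified] k(1)]
    note right = right_scan[of K U R \<eta> k' x', folded b_def d_def, OF k'(2)[simplified] k'(1)]
    have "agree_off (L - 1 + int k) (R - int k') (update p \<eta> U) (update p \<xi> U)"
      using left(2)[OF _ agree] right(2)[OF _ agree] by (auto simp: agree_off_def)
    moreover have "L - 1 + int k \<le> R - int k'" using len k(1) k'(1) by linarith
    ultimately have "\<bar>f (update p \<eta> U) - f (update p \<xi> U)\<bar>
        \<le> C * potential \<theta> H0 H1 (update p \<eta> U) (L - 1 + int k) (R - int k')"
      by (intro lip)
    also have "L - 1 + int k - 1 = L - 2 + int k" "R - int k' + 1 = R + 1 - int k'" by simp_all
    \<comment> \<open>The length changes by \<open>1 - k - k'\<close>, whence the summand 1 in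
      \<open>e\<close>.\<close>
    then have "C * potential \<theta> H0 H1 (update p \<eta> U) (L - 1 + int k) (R - int k') = V * e (k, x) (k', x')"
      using left(1) right(1) unfolding V_def e_def potential_def
      by (simp add: exp_add[symmetric] a_def b_def algebra_simps)
    also have "\<dots> = V * e (k, x) (k', x') * indicator (cyl (k, x) (k', x')) U"
      using k(2) k'(2) by (simp add: cyl_def)
    also have "\<dots> \<le> (\<Sum>u'\<in>A. V * e (k, x) u' * indicator (cyl (k, x) u') U)"
      using V k'(1) by (intro member_le_sum) (auto simp: A_def e_def)
    also have "\<dots> \<le> G U"
      unfolding G_def using V k(1)
      by (intro member_le_sum[of "(k, x)" A "\<lambda>u. \<Sum>u'\<in>A. V * e u u' * indicator (cyl u u') U"] sum_nonneg)
        (auto simp: A_def e_def)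
    finally show ?thesis .
  qed
  from kernel_difference_bound[OF f B G this] show ?thesis
    unfolding int_G V_def A_def e_def by simp
qed

text \<open>
  If the interval is short, the new length and correctors are bounded, and the interval disappears with a
  probability bounded below, which outweighs the growth factor for small \<open>\<theta>\<close>.
\<close>

lemma short_interval_bound:
  fixes f :: "config \<Rightarrow> real"
  assumes f: "f \<in> borel_measurable configs" and B: "\<And>x. \<bar>f x\<bar> \<le> B"
    and len: "L \<le> R" "R - L < 2 * int K" and agree: "agree_off L R \<eta> \<xi>" and "0 \<le> C" "0 \<le> \<theta>"
    and lip: "\<And>\<eta>' \<xi>' L' R'. L' \<le> R' \<Longrightarrow> agree_off L' R' \<eta>' \<xi>' \<Longrightarrow>
      \<bar>f \<eta>' - f \<xi>'\<bar> \<le> C * potential \<theta> H0 H1 \<eta>' L' R'"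
    and hb: "\<And>x. \<bar>H0 x\<bar> \<le> h" "\<And>x. \<bar>H1 x\<bar> \<le> h"
  shows "\<bar>(\<integral>x. f x \<partial>pca_kernel p \<eta>) - (\<integral>x. f x \<partial>pca_kernel p \<xi>)\<bar> \<le>
    C * potential \<theta> H0 H1 \<eta> L R * (exp (\<theta> * (1 + 4 * h)) * (1 - (1 - r_all p) ^ (2 * K + 1)))"
proof -
  interpret F: prob_space noise_field by (rule prob_space_noise_field)
  \<comment> \<open>The sites \<open>L - 1\<close> to \<open>R\<close> are those that read the
    interval. On \<open>D\<close> all are forced whatever they read, and the disagreement
    vanishes.\<close>
  define D where "D = {U. \<forall>i\<in>{L - 1..R}. U i \<in> {..<p_all p} \<union> {1 - q_all p..}}"
  define V where "V = C * potential \<theta> H0 H1 \<eta> L R * exp (\<theta> * (1 + 4 * h))"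
  have V: "0 \<le> V" using \<open>0 \<le> C\<close> by (simp add: V_def potential_def)
  have D: "D \<in> sets noise_field"
    unfolding D_def by (rule cylinder_sets) auto
  have r: "1 - r_all p = 1 - (1 - q_all p - p_all p)" by (simp add: r_all_def)
  have "measure noise_field D = (\<Prod>i\<in>{L - 1..R}. measure noise ({..<p_all p} \<union> {1 - q_all p..}))"
    unfolding D_def by (rule measure_cylinder) auto
  also have "\<dots> = (1 - r_all p) ^ nat (R - L + 2)"
    using p_all_pos q_all_pos r_all_bounds unfolding r
    by (subst measure_noise_gap) (auto simp: r_all_def add.commute)
  \<comment> \<open>There are \<open>R - L + 2\<close> sites, and
    \<open>R - L \<le> 2 * K - 1\<close>.\<close>
  also have "\<dots> \<ge> (1 - r_all p) ^ (2 * K + 1)"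
    using r_all_bounds len by (intro power_decreasing) auto
  finally have prob_D: "(1 - r_all p) ^ (2 * K + 1) \<le> measure noise_field D" .
  define G where "G U = V * (1 - indicator D U)" for U :: "int \<Rightarrow> real"
  have ind: "integrable noise_field (indicator D :: _ \<Rightarrow> real)"
    using D by (intro integrable_real_indicator) (auto simp: F.emeasure_eq_measure)
  have G: "integrable noise_field G"
    unfolding G_def using ind by (intro integrable_mult_right Bochner_Integration.integrable_diff) auto
  have "(\<integral>U. G U \<partial>noise_field) = V * (1 - measure noise_field D)"
    unfolding G_def using ind D F.prob_space by (simp add: Bochner_Integration.integral_diff)
  also have "\<dots> \<le> V * (1 - (1 - r_all p) ^ (2 * K + 1))"
    using prob_D V by (intro mult_left_mono) auto
  finally have int_G: "(\<integral>U. G U \<partial>noise_field) \<le> V * (1 - (1 - r_all p) ^ (2 * K + 1))" .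
  have out: "update p \<eta> U i = update p \<xi> U i" if "i < L - 1 \<or> R < i" for U i
    using that agree by (auto simp: update_def agree_off_def)
  have "\<bar>f (update p \<eta> U) - f (update p \<xi> U)\<bar> \<le> G U" for U
  proof (cases "U \<in> D")
    case True
    have "update p \<eta> U i = update p \<xi> U i" for i
    proof (cases "i \<in> {L - 1..R}")
      case i: True
      then have "U i < p_all p \<or> 1 - q_all p \<le> U i" using True unfolding D_def by blast
      then show ?thesis using update_known_interior by blast
    next
      case False
      then show ?thesis by (intro out) auto
    qed
    then have "update p \<eta> U = update p \<xi> U" by blast
    then show ?thesis using True by (simp add: G_def)
  next
    case False
    have "\<bar>f (update p \<eta> U) - f (update p \<xi> U)\<bar> \<le> C * potential \<theta> H0 H1 (update p \<eta> U) (L - 1) R"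
      using len out by (intro lip) (auto simp: agree_off_def)
    also have "\<dots> \<le> C * (potential \<theta> H0 H1 \<eta> L R * exp (\<theta> * (1 + 4 * h)))"
    proof (intro mult_left_mono \<open>0 \<le> C\<close>)
      \<comment> \<open>The length grows by 1, and the two old and two new corrector values
        contribute at most \<open>h\<close> each.\<close>
      have "of_int (R - (L - 1)) + H0 (update p \<eta> U (L - 1 - 1)) + H1 (update p \<eta> U (R + 1))
          \<le> of_int (R - L) + H0 (\<eta> (L - 1)) + H1 (\<eta> (R + 1)) + (1 + 4 * h)"
        using hb(1)[of "update p \<eta> U (L - 1 - 1)"] hb(2)[of "update p \<eta> U (R + 1)"]
          hb(1)[of "\<eta> (L - 1)"] hb(2)[of "\<eta> (R + 1)"]
        unfolding abs_le_iff by simp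
      then have "\<theta> * (of_int (R - (L - 1)) + H0 (update p \<eta> U (L - 1 - 1)) + H1 (update p \<eta> U (R + 1)))
          \<le> \<theta> * (of_int (R - L) + H0 (\<eta> (L - 1)) + H1 (\<eta> (R + 1)) + (1 + 4 * h))"
        using \<open>0 \<le> \<theta>\<close> by (rule mult_left_mono)
      then show "potential \<theta> H0 H1 (update p \<eta> U) (L - 1) R \<le> potential \<theta> H0 H1 \<eta> L R * exp (\<theta> * (1 + 4 * h))"
        unfolding potential_def exp_add[symmetric] exp_le_cancel_iff by (simp only: distrib_left)
    qed
    also have "\<dots> = G U" using False by (simp add: G_def V_def)
    finally show ?thesis .
  qed
  from kernel_difference_bound[OF f B G this] int_G show ?thesis
    unfolding V_def by (simp only: mult.assoc)
qed

text \<open>Contraction in dual form: an observable with Lipschitz constant \<open>C\<close>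
  relative to \<open>V\<close> is averaged into one with constant \<open>C * \<rho>\<close>, a
  statement that can be iterated in time.\<close>

definition contracts :: "real \<Rightarrow> (config \<Rightarrow> int \<Rightarrow> int \<Rightarrow> real) \<Rightarrow> bool" where
  "contracts \<rho> V \<longleftrightarrow> (\<forall>f B C L R \<eta> \<xi>.
     f \<in> borel_measurable configs \<longrightarrow> (\<forall>x. \<bar>f x\<bar> \<le> B) \<longrightarrow> L \<le> R \<longrightarrow> agree_off L R \<eta> \<xi> \<longrightarrow> 0 \<le> C \<longrightarrow>
     (\<forall>\<eta>' \<xi>' L' R'. L' \<le> R' \<longrightarrow> agree_off L' R' \<eta>' \<xi>' \<longrightarrow> \<bar>f \<eta>' - f \<xi>'\<bar> \<le> C * V \<eta>' L' R') \<longrightarrow>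
     \<bar>(\<integral>x. f x \<partial>pca_kernel p \<eta>) - (\<integral>x. f x \<partial>pca_kernel p \<xi>)\<bar> \<le> C * \<rho> * V \<eta> L R)"

lemma contraction:
  assumes "2 - r_all p > mean_rate False + mean_rate True"
  obtains \<theta> \<rho> H0 H1 where "0 \<le> \<theta>" "0 \<le> \<rho>" "\<rho> < 1" "contracts \<rho> (potential \<theta> H0 H1)"
proof -
  obtain K where K: "2 \<le> K" "1 < mean_shift K * ((1 - mean_rate False) + (1 - mean_rate True))"
    using large_mean_shift[OF assms] .
  obtain H0 where H0: "\<And>a c y. c = par_at p True a y \<Longrightarrow>
      (\<Sum>k\<le>K. \<Sum>x\<in>UNIV. scan_prob (scan_lo False a c) (scan_hi False a c) K k x * (H0 x - H0 a - real k))
       \<le> - mean_shift K * (1 - mean_rate False)"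
    using corrector_exists[OF K(1), of False] by auto
  obtain H1 where H1: "\<And>a c y. c = par_at p False a y \<Longrightarrow>
      (\<Sum>k\<le>K. \<Sum>x\<in>UNIV. scan_prob (scan_lo True a c) (scan_hi True a c) K k x * (H1 x - H1 a - real k))
       \<le> - mean_shift K * (1 - mean_rate True)"
    using corrector_exists[OF K(1), of True] by auto
  define h where "h = Max (range (\<lambda>x. \<bar>H0 x\<bar>) \<union> range (\<lambda>x. \<bar>H1 x\<bar>))"
  have hb: "\<bar>H0 x\<bar> \<le> h" "\<bar>H1 x\<bar> \<le> h" for x
    unfolding h_def by (intro Max_ge; simp)+
  have h: "0 \<le> h" using hb(1)[of True] by linarith
  \<comment> \<open>Bounds the change of length plus correctors in one step: both scans move by at
    most \<open>K\<close>, and four corrector values enter.\<close>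
  define Z where "Z = 1 + 2 * real K + 4 * h"
  have Z: "1 \<le> Z" "1 + 4 * h \<le> Z" using h by (auto simp: Z_def)
  define e where "e = mean_shift K * ((1 - mean_rate False) + (1 - mean_rate True)) - 1"
  have e: "0 < e" using K(2) by (simp add: e_def)
  define \<delta> where "\<delta> = (1 - r_all p) ^ (2 * K + 1)"
  have \<delta>: "0 < \<delta>" "\<delta> \<le> 1"
    unfolding \<delta>_def using r_all_bounds by (intro zero_less_power power_le_one; simp)+
  \<comment> \<open>The first bound keeps the quadratic error below half of the drift for long
    intervals; the second keeps the growth factor of short ones below
    \<open>1 + \<delta> / 2\<close>, which the vanishing probability \<open>\<delta>\<close>
    outweighs.\<close>
  define \<theta> where "\<theta> = min (e / (2 * Z\<^sup>2)) (\<delta> / (4 * Z))"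
  have \<theta>: "0 < \<theta>" "\<theta> * Z \<le> \<delta> / 4" "\<theta> * Z\<^sup>2 \<le> e / 2"
  proof -
    show "0 < \<theta>" using e \<delta> Z by (simp add: \<theta>_def)
    have "\<theta> \<le> \<delta> / (4 * Z)" "\<theta> \<le> e / (2 * Z\<^sup>2)" by (auto simp: \<theta>_def)
    then show "\<theta> * Z \<le> \<delta> / 4" "\<theta> * Z\<^sup>2 \<le> e / 2"
      using Z by (auto simp: field_simps)
  qed
  have \<theta>1: "\<theta> * Z \<le> 1" using \<theta> \<delta> by linarith
  define \<rho> where "\<rho> = max (1 - \<theta> * e / 2) (1 - \<delta> / 2)"
  have \<rho>: "0 \<le> \<rho>" "\<rho> < 1" using \<theta> e \<delta> by (auto simp: \<rho>_def)
  have short: "exp (\<theta> * (1 + 4 * h)) * (1 - \<delta>) \<le> \<rho>"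
  proof -
    have "exp (\<theta> * (1 + 4 * h)) \<le> exp (\<theta> * Z)" using Z \<theta> by simp
    also have "\<dots> \<le> 1 + \<theta> * Z + (\<theta> * Z)\<^sup>2"
      using \<theta> Z \<theta>1 by (intro exp_le_quadratic) simp
    also have "(\<theta> * Z)\<^sup>2 \<le> \<theta> * Z"
      using \<theta> Z \<theta>1 unfolding power2_eq_square by (intro mult_left_le) auto
    finally have "exp (\<theta> * (1 + 4 * h)) \<le> 1 + \<delta> / 2" using \<theta>(2) by linarith
    then have "exp (\<theta> * (1 + 4 * h)) * (1 - \<delta>) \<le> (1 + \<delta> / 2) * (1 - \<delta>)"
      using \<delta> by (intro mult_right_mono) auto
    also have "\<dots> \<le> 1 - \<delta> / 2" using \<delta> by (simp add: algebra_simps)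
    also have "\<dots> \<le> \<rho>" by (simp add: \<rho>_def)
    finally show ?thesis .
  qed
  show ?thesis
  proof (rule that[of \<theta> \<rho> H0 H1])
    show "contracts \<rho> (potential \<theta> H0 H1)"
      unfolding contracts_def
    proof (intro allI impI)
      fix f :: "config \<Rightarrow> real" and B C :: real and L R :: int and \<eta> \<xi> :: config
      assume fm: "f \<in> borel_measurable configs" and fB: "\<forall>x. \<bar>f x\<bar> \<le> B"
        and LR: "L \<le> R" and agree: "agree_off L R \<eta> \<xi>" and C: "0 \<le> C"
        and lip': "\<forall>\<eta>' \<xi>' L' R'. L' \<le> R' \<longrightarrow> agree_off L' R' \<eta>' \<xi>' \<longrightarrow>
          \<bar>f \<eta>' - f \<xi>'\<bar> \<le> C * potential \<theta> H0 H1 \<eta>' L' R'"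
      note f = fm fB[rule_format] and lip = lip'[rule_format]
      let ?lhs = "\<bar>(\<integral>x. f x \<partial>pca_kernel p \<eta>) - (\<integral>x. f x \<partial>pca_kernel p \<xi>)\<bar>"
      have CV: "0 \<le> C * potential \<theta> H0 H1 \<eta> L R" using C by (simp add: potential_def)
      show "?lhs \<le> C * \<rho> * potential \<theta> H0 H1 \<eta> L R"
      proof (cases "R - L < 2 * int K")
        case True
        have "?lhs \<le> C * potential \<theta> H0 H1 \<eta> L R * (exp (\<theta> * (1 + 4 * h)) * (1 - \<delta>))"
          unfolding \<delta>_def
          using \<theta> by (intro short_interval_bound[OF f LR True agree C _ lip hb]) auto
        also have "\<dots> \<le> C * potential \<theta> H0 H1 \<eta> L R * \<rho>"
          by (rule mult_left_mono[OF short CV])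
        finally show ?thesis by (simp add: mult_ac)
      next
        case False
        define a b c d where "a = \<eta> (L - 1)" and "b = \<eta> (R + 1)"
          and "c = p (\<eta> (L - 2)) (\<eta> (L - 1))" and "d = p (\<eta> (R + 1)) (\<eta> (R + 2))"
        define w where "w = (\<lambda>(k, x). scan_prob (scan_lo False a c) (scan_hi False a c) K k x)"
        define v where "v = (\<lambda>(k, x). scan_prob (scan_lo True b d) (scan_hi True b d) K k x)"
        let ?A = "{..K} \<times> (UNIV :: bool set)"
        let ?f = "\<lambda>u :: nat \<times> bool. H0 (snd u) - H0 a - real (fst u)"
        let ?g = "\<lambda>u :: nat \<times> bool. H1 (snd u) - H1 b - real (fst u)"
        have cd: "0 \<le> c" "c \<le> 1" "0 \<le> d" "d \<le> 1"
          unfolding c_def d_def using p01 less_imp_le by blast+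
        have "(\<Sum>u\<in>?A. \<Sum>u'\<in>?A. w u * v u' * exp (\<theta> * (1 + ?f u + ?g u'))) \<le> 1 - \<theta> * e + (\<theta> * Z)\<^sup>2"
        proof (rule exp_moment_bound)
          show "0 \<le> w u" "0 \<le> v u" for u
            using scan_prob_nonneg[OF scan_thresholds] cd by (auto simp: w_def v_def split: prod.split)
          show "sum w ?A = 1"
            using scan_mass[of "scan_lo False a c" "scan_hi False a c" K]
            by (simp add: w_def sum.cartesian_product[symmetric] UNIV_bool sum.distrib scan_lo_def scan_hi_def)
          show "sum v ?A = 1"
            using scan_mass[of "scan_lo True b d" "scan_hi True b d" K]
            by (simp add: v_def sum.cartesian_product[symmetric] UNIV_bool sum.distrib scan_lo_def scan_hi_def)
          show "\<bar>1 + ?f u + ?g u'\<bar> \<le> Z" if "u \<in> ?A" "u' \<in> ?A" for u u'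
          proof -
            have "real (fst u) \<le> real K" "real (fst u') \<le> real K" using that by auto
            then show ?thesis
              using hb(1)[of "snd u"] hb(2)[of "snd u'"] hb(1)[of a] hb(2)[of b]
              unfolding Z_def by linarith
          qed
          have "c = par_at p True a (\<eta> (L - 2))" "d = par_at p False b (\<eta> (R + 2))"
            by (simp_all add: par_at_def a_def b_def c_def d_def)
          note H0[OF this(1)] H1[OF this(2)]
          then have "(\<Sum>u\<in>?A. w u * ?f u) \<le> - mean_shift K * (1 - mean_rate False)"
            "(\<Sum>u\<in>?A. v u * ?g u) \<le> - mean_shift K * (1 - mean_rate True)"
            unfolding sum.cartesian_product by (simp_all add: w_def v_def case_prod_unfold)
          then show "1 + (\<Sum>u\<in>?A. w u * ?f u) + (\<Sum>u\<in>?A. v u * ?g u) \<le> - e"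
            unfolding e_def by (simp add: algebra_simps)
        qed (use \<theta> \<theta>1 in auto)
        also have "\<dots> = 1 - \<theta> * e + \<theta> * (\<theta> * Z\<^sup>2)" by (simp add: power2_eq_square)
        also have "\<dots> \<le> 1 - \<theta> * e + \<theta> * (e / 2)"
          using \<theta> by (intro add_left_mono mult_left_mono) auto
        also have "\<dots> \<le> \<rho>" by (simp add: \<rho>_def)
        finally have sum: "(\<Sum>u\<in>?A. \<Sum>u'\<in>?A. w u * v u' * exp (\<theta> * (1 + ?f u + ?g u'))) \<le> \<rho>" .
        have "?lhs \<le> C * potential \<theta> H0 H1 \<eta> L R *
            (\<Sum>u\<in>?A. \<Sum>u'\<in>?A. w u * v u' * exp (\<theta> * (1 + ?f u + ?g u')))"
          unfolding w_def v_def a_def b_def c_def d_def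
          by (rule long_interval_bound[OF f _ agree C lip]) (use False in auto)
        also have "\<dots> \<le> C * potential \<theta> H0 H1 \<eta> L R * \<rho>"
          by (rule mult_left_mono[OF sum CV])
        finally show ?thesis by (simp add: mult_ac)
      qed
    qed
  qed (use \<theta> \<rho> in auto)
qed

end

section \<open>Configurations as a Cantor set\<close>

text \<open>Digits 0 and 1 in base 3 leave gaps, which makes the expansion unique;
  \<open>int_decode\<close> enumerates the sites.\<close>

definition code :: "config \<Rightarrow> real" where
  "code x = (\<Sum>n. of_bool (x (int_decode n)) * (1 / 3) ^ n)"

lemma summable_code: "summable (\<lambda>n. of_bool (x (int_decode n)) * (1 / 3 :: real) ^ n)"
  by (rule summable_comparison_test'[OF summable_geometric[of "1 / 3 :: real"], of 0]) auto

lemma code_bounds: "0 \<le> code x" "code x \<le> 3 / 2"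
proof -
  show "0 \<le> code x"
    unfolding code_def by (intro suminf_nonneg summable_code) auto
  have "code x \<le> (\<Sum>n. (1 / 3 :: real) ^ n)"
    unfolding code_def by (intro suminf_le summable_code summable_geometric) auto
  then show "code x \<le> 3 / 2"
    by (simp add: suminf_geometric)
qed

lemma continuous_code: "continuous_on UNIV code"
proof -
  have "uniform_limit UNIV (\<lambda>N x. \<Sum>n<N. of_bool (x (int_decode n)) * (1 / 3 :: real) ^ n) code sequentially"
    unfolding code_def[abs_def]
    by (rule Weierstrass_m_test[of _ _ "\<lambda>n. (1 / 3 :: real) ^ n"]) (auto simp: summable_geometric)
  moreover have "continuous_on UNIV (\<lambda>x :: config. of_bool (x i) :: real)" for i
    by (rule continuous_on_compose2[of UNIV "of_bool :: bool \<Rightarrow> real" UNIV "\<lambda>x :: config. x i"]) auto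
  then have "\<forall>\<^sub>F N in sequentially.
      continuous_on UNIV (\<lambda>x :: config. \<Sum>n<N. of_bool (x (int_decode n)) * (1 / 3 :: real) ^ n)"
    by (intro always_eventually allI continuous_on_sum continuous_on_mult continuous_on_const)
  ultimately show ?thesis
    by (rule uniform_limit_theorem[OF _ _ trivial_limit_sequentially, rotated])
qed

text \<open>At the first differing digit \<open>m\<close> the codes differ by
  \<open>(1 / 3) ^ m\<close>, and the later digits can compensate at most half of that.\<close>

lemma inj_code: "inj code"
proof (rule injI, rule ccontr)
  fix x y :: config
  assume eq: "code x = code y" and "x \<noteq> y"
  define d :: "nat \<Rightarrow> real" where
    "d = (\<lambda>n. of_bool (x (int_decode n)) - of_bool (y (int_decode n)))"
  from \<open>x \<noteq> y\<close> obtain i where "x i \<noteq> y i" by auto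
  then have ex: "\<exists>n. d n \<noteq> 0"
    by (intro exI[of _ "int_encode i"]) (auto simp: d_def)
  define m where "m = (LEAST n. d n \<noteq> 0)"
  have m: "d m \<noteq> 0" unfolding m_def using ex by (rule LeastI_ex)
  have below: "d n = 0" if "n < m" for n using not_less_Least that unfolding m_def by blast
  have sd: "summable (\<lambda>n. d n * (1 / 3) ^ n)"
    using summable_diff[OF summable_code[of x] summable_code[of y]]
    by (simp add: d_def left_diff_distrib)
  have "(\<Sum>n. d n * (1 / 3) ^ n) = code x - code y"
    unfolding code_def d_def using suminf_diff[OF summable_code[of x] summable_code[of y]]
    by (simp add: left_diff_distrib)
  then have "0 = (\<Sum>n. d n * (1 / 3) ^ n)" using eq by simp
  also have "\<dots> = (\<Sum>n. d (n + Suc m) * (1 / 3) ^ (n + Suc m)) + (\<Sum>n<Suc m. d n * (1 / 3) ^ n)"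
    using sd by (rule suminf_split_initial_segment)
  also have "(\<Sum>n<Suc m. d n * (1 / 3) ^ n) = d m * (1 / 3) ^ m"
    by (simp add: below)
  finally have tail: "(\<Sum>n. d (n + Suc m) * (1 / 3) ^ (n + Suc m)) = - (d m * (1 / 3) ^ m)"
    by simp
  have geo: "summable (\<lambda>n. (1 / 3 :: real) ^ n * (1 / 3) ^ Suc m)"
    by (intro summable_mult2 summable_geometric) simp
  have dn: "norm (d (n + Suc m) * (1 / 3) ^ (n + Suc m)) \<le> (1 / 3) ^ n * (1 / 3) ^ Suc m" for n
    by (auto simp: d_def power_add abs_mult)
  have "norm (\<Sum>n. d (n + Suc m) * (1 / 3) ^ (n + Suc m)) \<le> (\<Sum>n. (1 / 3) ^ n * (1 / 3) ^ Suc m)"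
    using dn geo by (rule norm_suminf_le)
  also have "\<dots> = 3 / 2 * (1 / 3) ^ Suc m"
    using suminf_mult2[OF summable_geometric[of "1 / 3 :: real"], of "(1 / 3) ^ Suc m"]
    by (simp add: suminf_geometric)
  also have "\<dots> < (1 / 3) ^ m" by simp
  also have "\<dots> = norm (- (d m * (1 / 3) ^ m))"
    using m by (auto simp: d_def abs_mult split: if_splits)
  finally show False using tail by simp
qed

lemma compact_configs: "compact (UNIV :: config set)"
proof -
  have "compact (UNIV :: bool set)" by (rule finite_imp_compact) simp
  then have "compact_space (euclidean :: bool topology)" by (simp add: compact_space_def)
  then have "compact_space (product_topology (\<lambda>_ :: int. euclidean :: bool topology) UNIV)"
    by (simp add: compact_space_product_topology)
  then show ?thesis
    by (simp add: euclidean_product_topology compact_space_def)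
qed

definition decode :: "real \<Rightarrow> config" where
  "decode = the_inv_into UNIV code"

lemma decode_code [simp]: "decode (code x) = x"
  unfolding decode_def by (rule the_inv_into_f_f[OF inj_code]) simp

lemma compact_range_code: "compact (range code)"
  by (rule compact_continuous_image[OF continuous_code compact_configs])

lemma continuous_decode: "continuous_on (range code) decode"
  by (rule continuous_on_inv[OF continuous_code compact_configs]) simp

text \<open>\<open>code\<close> is a homeomorphism onto a compact set, and Tietze extends the
  transported function to the line, where weak convergence on the reals applies.\<close>

lemma continuous_factorization:
  fixes f :: "config \<Rightarrow> real"
  assumes "continuous_on UNIV f"
  obtains g where "continuous_on UNIV g" "\<And>x. g (code x) = f x" "bounded (range g)"
proof -
  have "continuous_on (range code) (\<lambda>y. f (decode y))"
    by (rule continuous_on_compose2[OF assms continuous_decode]) auto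
  moreover have "closedin (top_of_set UNIV) (range code)"
    using compact_range_code by (simp add: compact_imp_closed)
  moreover obtain B where "\<And>x. norm (f x) \<le> B"
    using compact_imp_bounded[OF compact_continuous_image[OF assms compact_configs]]
    unfolding bounded_iff by auto
  moreover from this[of undefined] have "0 \<le> B" by (rule order_trans[OF norm_ge_zero])
  ultimately obtain g where "continuous_on UNIV g" "\<And>y. y \<in> range code \<Longrightarrow> g y = f (decode y)"
      "\<And>x. norm (g x) \<le> B"
    using Tietze[of "range code" "\<lambda>y. f (decode y)" UNIV B] by auto
  then show ?thesis by (intro that[of g]) (auto simp: bounded_iff)
qed

lemma continuous_bounded_configs:
  fixes f :: "config \<Rightarrow> real"
  assumes "continuous_on UNIV f"
  obtains B where "\<And>x. \<bar>f x\<bar> \<le> B"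
  using compact_imp_bounded[OF compact_continuous_image[OF assms compact_configs]]
  unfolding bounded_iff by auto

lemma borel_measurable_configs_continuous:
  assumes "continuous_on UNIV f"
  shows "f \<in> borel_measurable configs"
  using borel_measurable_continuous_onI[OF assms] by (simp cong: measurable_cong_sets add: sets_configs)

lemma code_diff_le:
  assumes "\<And>n. n < N \<Longrightarrow> x (int_decode n) = y (int_decode n)"
  shows "\<bar>code x - code y\<bar> \<le> 3 / 2 * (1 / 3) ^ N"
proof -
  define d :: "nat \<Rightarrow> real" where
    "d = (\<lambda>n. (of_bool (x (int_decode n)) - of_bool (y (int_decode n))) * (1 / 3) ^ n)"
  have sd: "summable d"
    using summable_diff[OF summable_code[of x] summable_code[of y]]
    by (simp add: d_def left_diff_distrib)
  have "code x - code y = (\<Sum>n. d n)"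
    unfolding code_def d_def using suminf_diff[OF summable_code[of x] summable_code[of y]]
    by (simp add: left_diff_distrib)
  also have "\<dots> = (\<Sum>n. d (n + N)) + (\<Sum>n<N. d n)"
    using sd by (rule suminf_split_initial_segment)
  also have "(\<Sum>n<N. d n) = 0"
    using assms by (intro sum.neutral) (auto simp: d_def)
  finally have "\<bar>code x - code y\<bar> = norm (\<Sum>n. d (n + N))" by simp
  also have "\<dots> \<le> (\<Sum>n. (1 / 3) ^ n * (1 / 3) ^ N)"
    by (rule norm_suminf_le) (auto simp: d_def power_add abs_mult intro!: summable_mult2 summable_geometric)
  also have "\<dots> = 3 / 2 * (1 / 3) ^ N"
    using suminf_mult2[OF summable_geometric[of "1 / 3 :: real"], of "(1 / 3) ^ N"]
    by (simp add: suminf_geometric)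
  finally show ?thesis .
qed

lemma continuous_almost_local:
  fixes f :: "config \<Rightarrow> real"
  assumes f: "continuous_on UNIV f" and "e > 0"
  obtains m :: nat where "\<And>x y. (\<And>i. \<bar>i\<bar> \<le> int m \<Longrightarrow> x i = y i) \<Longrightarrow> \<bar>f x - f y\<bar> < e"
proof -
  have "continuous_on (range code) (\<lambda>y. f (decode y))"
    by (rule continuous_on_compose2[OF f continuous_decode]) auto
  then have "uniformly_continuous_on (range code) (\<lambda>y. f (decode y))"
    by (rule compact_uniformly_continuous[OF _ compact_range_code])
  then obtain d where d: "d > 0" "\<And>x y. dist (code x) (code y) < d \<Longrightarrow> dist (f x) (f y) < e"
    using \<open>e > 0\<close> unfolding uniformly_continuous_on_def by (metis decode_code rangeI)
  obtain N where N: "(1 / 3 :: real) ^ N < d * 2 / 3"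
    using real_arch_pow_inv[of "d * 2 / 3" "1 / 3"] d(1) by auto
  \<comment> \<open>A window containing the first \<open>N\<close> enumerated sites;
    \<open>{..N}\<close> keeps the set nonempty when \<open>N = 0\<close>.\<close>
  define m where "m = nat (Max ((\<lambda>n. \<bar>int_decode n\<bar>) ` {..N}))"
  have le: "\<bar>int_decode n\<bar> \<le> int m" if "n < N" for n
  proof -
    have "\<bar>int_decode n\<bar> \<le> Max ((\<lambda>n. \<bar>int_decode n\<bar>) ` {..N})"
      using that by (intro Max_ge) auto
    then show ?thesis unfolding m_def by linarith
  qed
  show ?thesis
  proof (rule that)
    fix x y :: config
    assume "\<And>i. \<bar>i\<bar> \<le> int m \<Longrightarrow> x i = y i"
    then have "\<bar>code x - code y\<bar> \<le> 3 / 2 * (1 / 3) ^ N"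
      by (intro code_diff_le) (use le in auto)
    also have "\<dots> < d" using N by simp
    finally show "\<bar>f x - f y\<bar> < e" using d(2)[of x y] by (simp add: dist_real_def)
  qed
qed

text \<open>The images under \<open>code\<close> live in a bounded interval and are therefore tight.
  A limit along a subsequence is carried by the closed set \<open>range code\<close> and can be
  pulled back.\<close>

lemma weak_limit_exists:
  fixes \<mu> :: "nat \<Rightarrow> config measure"
  assumes "\<And>n. config_distribution (\<mu> n)"
  obtains r \<nu> where "strict_mono (r :: nat \<Rightarrow> nat)" "config_distribution \<nu>"
    "\<And>f :: config \<Rightarrow> real. continuous_on UNIV f \<Longrightarrow>
      (\<lambda>n. \<integral>x. f x \<partial>\<mu> (r n)) \<longlonglongrightarrow> (\<integral>x. f x \<partial>\<nu>)"
proof -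
  have code_m [measurable]: "code \<in> borel_measurable configs"
    by (rule borel_measurable_configs_continuous[OF continuous_code])
  have mu: "prob_space (\<mu> n)" and sets_mu: "sets (\<mu> n) = sets configs" for n
    using assms by (auto simp: config_distribution_def)
  have space_mu: "space (\<mu> n) = UNIV" for n
    using sets_eq_imp_space_eq[OF sets_mu] by simp
  have code_mu: "code \<in> borel_measurable (\<mu> n)" for n
    using code_m by (simp cong: measurable_cong_sets add: sets_mu)
  define D where "D n = distr (\<mu> n) borel code" for n
  have D: "real_distribution (D n)" for n
  proof -
    interpret prob_space "\<mu> n" by (rule mu)
    show ?thesis unfolding D_def using code_mu by (rule real_distribution_distr)
  qed
  have "measure (D n) {-1<..2} = 1" for n
  proof -
    interpret prob_space "\<mu> n" by (rule mu)
    have "-1 < code x \<and> code x \<le> 2" for x using code_bounds[of x] by linarith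
    then have "code -` {-1<..2} \<inter> space (\<mu> n) = space (\<mu> n)"
      by auto
    then show ?thesis unfolding D_def using code_mu by (simp add: measure_distr prob_space)
  qed
  then have tight: "tight D"
    unfolding tight_def using D by (intro conjI allI impI exI[of _ "-1"] exI[of _ 2]) simp_all
  then obtain r M where r: "strict_mono (r :: nat \<Rightarrow> nat)" and M: "real_distribution M"
      and conv: "weak_conv_m (D \<circ> id \<circ> r) M"
    using tight_imp_convergent_subsubsequence[OF tight strict_mono_id] by blast
  interpret M: real_distribution M by (rule M)
  have lim: "(\<lambda>n. \<integral>x. g (code x) \<partial>\<mu> (r n)) \<longlonglongrightarrow> (\<integral>y. g y \<partial>M)"
    if g: "continuous_on UNIV g" and B: "bounded (range g)" for g :: "real \<Rightarrow> real"
  proof -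
    obtain B where "\<And>x. norm (g x) \<le> B" using B by (auto simp: bounded_iff)
    moreover have "isCont g x" for x using g by (simp add: continuous_on_eq_continuous_at)
    ultimately have "(\<lambda>n. \<integral>y. g y \<partial>(D \<circ> id \<circ> r) n) \<longlonglongrightarrow> (\<integral>y. g y \<partial>M)"
      using D M conv by (intro weak_conv_imp_integral_bdd_continuous_conv) (auto simp: comp_def)
    moreover have "g \<in> borel_measurable borel"
      using g by (rule borel_measurable_continuous_onI)
    ultimately show ?thesis
      by (simp add: D_def integral_distr[OF code_mu])
  qed
  have cl: "closed (range code)" and ne: "range code \<noteq> {}"
    using compact_range_code by (auto simp: compact_imp_closed)
  have supp: "AE y in M. y \<in> range code"
  proof -
    \<comment> \<open>A bounded continuous test function vanishing exactly on
      \<open>range code\<close>: its integrals along the sequence are 0, hence so is the limiting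
      one.\<close>
    define g where "g y = min 1 (setdist {y} (range code))" for y
    have g: "continuous_on UNIV g" unfolding g_def by (intro continuous_intros continuous_on_setdist)
    have gb: "0 \<le> g y" "g y \<le> 1" for y by (auto simp: g_def setdist_pos_le)
    have B: "bounded (range g)" unfolding bounded_iff using gb by (intro exI[of _ 1]) auto
    have "g (code x) = 0" for x
      by (simp add: g_def setdist_sing_in_set)
    then have "(\<integral>y. g y \<partial>M) = 0"
      using lim[OF g B] by (simp add: LIMSEQ_const_iff)
    moreover have gm: "g \<in> borel_measurable M"
      using borel_measurable_continuous_onI[OF g] by simp
    moreover have "integrable M g"
      using gb gm by (intro M.integrable_const_bound[of _ 1]) auto
    ultimately have "AE y in M. g y = 0"
      using integral_nonneg_eq_0_iff_AE[of M g] gb by simp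
    then show ?thesis
      by eventually_elim (use cl ne in \<open>auto simp: g_def setdist_eq_0_sing_1 min_def split: if_splits\<close>)
  qed
  \<comment> \<open>The default value is taken only on a null set of \<open>M\<close>.\<close>
  define dec where "dec y = (if y \<in> range code then decode y else undefined)" for y
  have dec_m: "dec \<in> M \<rightarrow>\<^sub>M configs"
  proof -
    have "dec \<in> borel \<rightarrow>\<^sub>M borel"
      unfolding dec_def using continuous_decode cl
      by (intro borel_measurable_continuous_on_if) auto
    then show ?thesis by (simp cong: measurable_cong_sets add: sets_configs)
  qed
  define \<nu> where "\<nu> = distr M configs dec"
  show ?thesis
  proof (rule that[OF r])
    show "config_distribution \<nu>"
      unfolding config_distribution_def \<nu>_def using M.prob_space_distr[OF dec_m] by simp
    fix f :: "config \<Rightarrow> real" assume f: "continuous_on UNIV f"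
    obtain g where g: "continuous_on UNIV g" "\<And>x. g (code x) = f x" "bounded (range g)"
      using continuous_factorization[OF f] by blast
    have "(\<integral>x. f x \<partial>\<nu>) = (\<integral>y. f (dec y) \<partial>M)"
      unfolding \<nu>_def using dec_m borel_measurable_configs_continuous[OF f] by (rule integral_distr)
    also have "\<dots> = (\<integral>y. g y \<partial>M)"
    proof (rule integral_cong_AE)
      show "AE y in M. f (dec y) = g y"
        using supp by eventually_elim (auto simp: dec_def g(2)[symmetric])
      show "(\<lambda>y. f (dec y)) \<in> borel_measurable M"
        using measurable_comp[OF dec_m borel_measurable_configs_continuous[OF f]] by (simp add: comp_def)
      show "g \<in> borel_measurable M"
        using borel_measurable_continuous_onI[OF g(1)] by simp
    qed
    finally show "(\<lambda>n. \<integral>x. f x \<partial>\<mu> (r n)) \<longlonglongrightarrow> (\<integral>x. f x \<partial>\<nu>)"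
      using lim[OF g(1,3)] by (simp add: g(2))
  qed
qed

section \<open>Forgetting the initial configuration\<close>

text \<open>The Markov semigroup acting on observables: the expectation of \<open>f\<close> at time
  \<open>t\<close> as a function of the initial configuration.\<close>

primrec evolve :: "(bool \<Rightarrow> bool \<Rightarrow> real) \<Rightarrow> (config \<Rightarrow> real) \<Rightarrow> nat \<Rightarrow> config \<Rightarrow> real" where
  "evolve p f 0 = f"
| "evolve p f (Suc t) = (\<lambda>\<eta>. \<integral>x. evolve p f t x \<partial>pca_kernel p \<eta>)"

lemma kernel_subprob: "pca_kernel p \<in> configs \<rightarrow>\<^sub>M subprob_algebra configs"
  by (rule measurable_prob_algebraD[OF measurable_pca_kernel])

lemma measurable_config_distribution:
  assumes "config_distribution \<mu>" "f \<in> borel_measurable configs"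
  shows "f \<in> borel_measurable \<mu>"
  using assms by (simp add: config_distribution_def cong: measurable_cong_sets)

lemma config_distribution_kernel: "config_distribution (pca_kernel p \<eta>)"
  by (simp add: config_distribution_def prob_space_pca_kernel sets_pca_kernel)

lemma integrable_config_distribution:
  fixes f :: "config \<Rightarrow> real"
  assumes "config_distribution \<mu>" "f \<in> borel_measurable configs" "\<And>x. \<bar>f x\<bar> \<le> B"
  shows "integrable \<mu> f"
proof -
  interpret prob_space \<mu> using assms(1) by (simp add: config_distribution_def)
  show ?thesis
    using assms(3) measurable_config_distribution[OF assms(1,2)] by (intro integrable_const_bound[of _ B]) auto
qed

lemma integral_config_distribution_between:
  fixes f :: "config \<Rightarrow> real"
  assumes \<mu>: "config_distribution \<mu>" and f: "f \<in> borel_measurable configs" and "\<And>x. l \<le> f x \<and> f x \<le> u"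
  shows "l \<le> (\<integral>x. f x \<partial>\<mu>) \<and> (\<integral>x. f x \<partial>\<mu>) \<le> u"
proof -
  interpret prob_space \<mu> using \<mu> by (simp add: config_distribution_def)
  have "\<bar>f x\<bar> \<le> max \<bar>l\<bar> \<bar>u\<bar>" for x using assms(3)[of x] by linarith
  then have "integrable \<mu> f" by (rule integrable_config_distribution[OF \<mu> f])
  then show ?thesis
    using assms(3) by (auto intro!: integral_ge_const integral_le_const)
qed

lemma evolve_measurable: "f \<in> borel_measurable configs \<Longrightarrow> evolve p f t \<in> borel_measurable configs"
proof (induction t)
  case (Suc t)
  then show ?case
    using measurable_compose[OF kernel_subprob integral_measurable_subprob_algebra] by simp
qed simp

text \<open>Averages stay within the bounds of what is averaged, so an oscillation bound at one time
  persists at all later times.\<close>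

lemma evolve_between:
  assumes f: "f \<in> borel_measurable configs" and "\<And>x. l \<le> evolve p f s x \<and> evolve p f s x \<le> u"
  shows "s \<le> t \<Longrightarrow> l \<le> evolve p f t x \<and> evolve p f t x \<le> u"
proof (induction t arbitrary: x rule: dec_induct)
  case base
  show ?case by (rule assms(2))
next
  case (step t)
  show ?case
    using integral_config_distribution_between[OF config_distribution_kernel evolve_measurable[OF f] step.IH]
    by simp
qed

lemma evolve_bounded:
  assumes f: "f \<in> borel_measurable configs" and "\<And>x. \<bar>f x\<bar> \<le> B"
  shows "\<bar>evolve p f t x\<bar> \<le> B"
  using evolve_between[OF f, of "- B" p 0 B t x] assms(2) by (auto simp: abs_le_iff minus_le_iff)

lemma integral_pca_law:
  fixes f :: "config \<Rightarrow> real"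
  assumes \<mu>: "config_distribution \<mu>0" and f: "f \<in> borel_measurable configs" and B: "\<And>x. \<bar>f x\<bar> \<le> B"
  shows "(\<integral>x. f x \<partial>pca_law p \<mu>0 t) = (\<integral>x. evolve p f t x \<partial>\<mu>0)"
proof -
  \<comment> \<open>Each induction step moves one kernel from the law to the observable, so
    \<open>s\<close> has to vary.\<close>
  have "(\<integral>x. evolve p f s x \<partial>pca_law p \<mu>0 t) = (\<integral>x. evolve p f (s + t) x \<partial>\<mu>0)" for s
  proof (induction t arbitrary: s)
    case (Suc t)
    let ?\<mu> = "pca_law p \<mu>0 t"
    have d: "config_distribution ?\<mu>" by (rule config_distribution_pca_law[OF \<mu>])
    then have m: "pca_kernel p \<in> ?\<mu> \<rightarrow>\<^sub>M subprob_algebra configs"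
      using kernel_subprob by (simp add: config_distribution_def cong: measurable_cong_sets)
    have "(\<integral>x. evolve p f s x \<partial>(?\<mu> \<bind> pca_kernel p)) = (\<integral>x. \<integral>y. evolve p f s y \<partial>pca_kernel p x \<partial>?\<mu>)"
    proof (rule integral_bind[OF evolve_measurable[OF f] _ m])
      show "\<bar>evolve p f s x\<bar> \<le> B" for x using evolve_bounded[OF f B] .
      show "finite_measure ?\<mu>" using d by (simp add: config_distribution_def prob_space.finite_measure)
      show "AE x in ?\<mu>. emeasure (pca_kernel p x) (space (pca_kernel p x)) \<le> ennreal 1"
        using prob_space.emeasure_space_1[OF prob_space_pca_kernel] by simp
    qed
    then show ?case using Suc[of "Suc s"] by simp
  qed simp
  from this[of 0] show ?thesis by simp
qed

lemma evolve_diff_le: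
  fixes f g :: "config \<Rightarrow> real"
  assumes f: "f \<in> borel_measurable configs" "\<And>x. \<bar>f x\<bar> \<le> B" and g: "g \<in> borel_measurable configs" "\<And>x. \<bar>g x\<bar> \<le> B'"
    and fg: "\<And>x. \<bar>f x - g x\<bar> \<le> e"
  shows "\<bar>evolve p f t \<eta> - evolve p g t \<eta>\<bar> \<le> e"
proof (induction t arbitrary: \<eta>)
  case (Suc t)
  have "evolve p f (Suc t) \<eta> - evolve p g (Suc t) \<eta> = (\<integral>x. evolve p f t x - evolve p g t x \<partial>pca_kernel p \<eta>)"
    using integrable_config_distribution[OF config_distribution_kernel evolve_measurable[OF f(1)] evolve_bounded[OF f]]
      integrable_config_distribution[OF config_distribution_kernel evolve_measurable[OF g(1)] evolve_bounded[OF g]]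
    by simp
  also have "\<bar>\<dots>\<bar> \<le> e"
  proof -
    have "- e \<le> evolve p f t x - evolve p g t x \<and> evolve p f t x - evolve p g t x \<le> e" for x
      using Suc[of x] by linarith
    from integral_config_distribution_between[OF config_distribution_kernel[of p \<eta>]
        borel_measurable_diff[OF evolve_measurable[OF f(1)] evolve_measurable[OF g(1)]] this]
    show ?thesis unfolding abs_le_iff by linarith
  qed
  finally show ?case .
qed (simp add: fg)

section \<open>Influence of single sites and convergence\<close>

context positive_rates
begin

text \<open>A site reads itself and its right neighbour, so the window of dependence grows by one
  site to the right per step.\<close>

lemma evolve_local:
  assumes f: "f \<in> borel_measurable configs" and loc: "\<And>x y. (\<And>i. \<bar>i\<bar> \<le> int m \<Longrightarrow> x i = y i) \<Longrightarrow> f x = f y"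
  shows "(\<And>i. - int m \<le> i \<Longrightarrow> i \<le> int m + int t \<Longrightarrow> \<eta> i = \<xi> i) \<Longrightarrow> evolve p f t \<eta> = evolve p f t \<xi>"
proof (induction t arbitrary: \<eta> \<xi>)
  case 0
  have "f \<eta> = f \<xi>" by (rule loc) (use 0 in \<open>simp add: abs_le_iff\<close>)
  then show ?case by simp
next
  case (Suc t)
  have "evolve p f t (update p \<eta> U) = evolve p f t (update p \<xi> U)" for U
    using Suc.prems by (intro Suc.IH) (simp add: update_def)
  then show ?case by (simp add: integral_pca_kernel'[OF evolve_measurable[OF f]])
qed

lemma evolve_oscillation_local:
  assumes cond: "2 - r_all p > mean_rate False + mean_rate True"
    and f: "f \<in> borel_measurable configs" "\<And>x. \<bar>f x\<bar> \<le> B"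
    and loc: "\<And>x y. (\<And>i. \<bar>i\<bar> \<le> int m \<Longrightarrow> x i = y i) \<Longrightarrow> f x = f y"
    and "0 < e"
  shows "\<forall>\<^sub>F t in sequentially. \<forall>\<eta> \<xi>. \<bar>evolve p f t \<eta> - evolve p f t \<xi>\<bar> < e"
proof -
  obtain \<theta> \<rho> H0 H1 where \<theta>: "0 \<le> \<theta>" and \<rho>: "0 \<le> \<rho>" "\<rho> < 1" and contr: "contracts \<rho> (potential \<theta> H0 H1)"
    using contraction[OF cond] .
  define h where "h = Max (range (\<lambda>x. \<bar>H0 x\<bar>) \<union> range (\<lambda>x. \<bar>H1 x\<bar>))"
  have hb: "\<bar>H0 x\<bar> \<le> h" "\<bar>H1 x\<bar> \<le> h" for x
    unfolding h_def by (intro Max_ge; simp)+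
  have h_bounds: "- (2 * h) \<le> H0 x + H1 y" "H0 x + H1 y \<le> 2 * h" for x y
    using hb(1)[of x] hb(2)[of y] by linarith+
  have pot_ge: "exp (- (\<theta> * (2 * h))) \<le> potential \<theta> H0 H1 \<eta> L R" if "L \<le> R" for \<eta> L R
  proof -
    have "- (2 * h) \<le> of_int (R - L) + H0 (\<eta> (L - 1)) + H1 (\<eta> (R + 1))"
      using h_bounds(1)[of "\<eta> (L - 1)" "\<eta> (R + 1)"] that by simp
    then have "\<theta> * - (2 * h) \<le> \<theta> * (of_int (R - L) + H0 (\<eta> (L - 1)) + H1 (\<eta> (R + 1)))"
      using \<theta> by (rule mult_left_mono)
    then show ?thesis by (simp add: potential_def)
  qed
  have pot_le: "potential \<theta> H0 H1 \<eta> L L \<le> exp (\<theta> * (2 * h))" for \<eta> L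
    unfolding potential_def exp_le_cancel_iff using \<theta> h_bounds(2) by (intro mult_left_mono) auto
  have B: "0 \<le> B" using f(2)[of undefined] by linarith
  \<comment> \<open>\<open>2 * B\<close> divided by the lower bound in \<open>pot_ge\<close>, so
    that the estimate holds at time 0.\<close>
  define C where "C = 2 * B * exp (\<theta> * (2 * h))"
  have C: "0 \<le> C" using B by (simp add: C_def)
  have decay: "\<bar>evolve p f t \<eta> - evolve p f t \<xi>\<bar> \<le> C * \<rho> ^ t * potential \<theta> H0 H1 \<eta> L R"
    if "L \<le> R" "agree_off L R \<eta> \<xi>" for t \<eta> \<xi> L R
    using that
  proof (induction t arbitrary: \<eta> \<xi> L R)
    case 0
    have "\<bar>f \<eta> - f \<xi>\<bar> \<le> C * exp (- (\<theta> * (2 * h)))"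
    proof -
      have "C * exp (- (\<theta> * (2 * h))) = 2 * B" by (simp add: C_def exp_minus field_simps)
      then show ?thesis using f(2)[of \<eta>] f(2)[of \<xi>] by linarith
    qed
    also have "\<dots> \<le> C * potential \<theta> H0 H1 \<eta> L R"
      using pot_ge[OF 0(1)] C by (intro mult_left_mono) auto
    finally show ?case by simp
  next
    case (Suc t)
    have "\<bar>evolve p f (Suc t) \<eta> - evolve p f (Suc t) \<xi>\<bar> \<le> C * \<rho> ^ t * \<rho> * potential \<theta> H0 H1 \<eta> L R"
      unfolding evolve.simps
    proof (rule contr[unfolded contracts_def, rule_format, where B = B])
      show "evolve p f t \<in> borel_measurable configs" by (rule evolve_measurable[OF f(1)])
      show "\<bar>evolve p f t x\<bar> \<le> B" for x by (rule evolve_bounded[OF f])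
      show "0 \<le> C * \<rho> ^ t" using C \<rho> by simp
    qed (rule Suc.prems Suc.IH; assumption)+
    then show ?case by (simp add: mult_ac)
  qed
  let ?c = "C * exp (\<theta> * (2 * h))"
  have osc: "\<bar>evolve p f t \<eta> - evolve p f t \<xi>\<bar> \<le> real (2 * m + 1 + t) * (?c * \<rho> ^ t)" for t \<eta> \<xi>
  proof -
    \<comment> \<open>Consecutive mixtures differ at most at site \<open>int j - int m\<close>. On
      the sites from \<open>- m\<close> to \<open>m + t\<close> they lead from \<open>\<eta>\<close>
      to \<open>\<xi>\<close> in \<open>2 * m + 1 + t\<close> steps.\<close>
    define mix where "mix j i = (if i < int j - int m then \<xi> i else \<eta> i)" for j i
    have step: "\<bar>evolve p f t (mix j) - evolve p f t (mix (Suc j))\<bar> \<le> ?c * \<rho> ^ t" for j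
    proof -
      have "\<bar>evolve p f t (mix j) - evolve p f t (mix (Suc j))\<bar>
          \<le> C * \<rho> ^ t * potential \<theta> H0 H1 (mix j) (int j - int m) (int j - int m)"
        by (rule decay) (auto simp: agree_off_def mix_def)
      also have "\<dots> \<le> C * \<rho> ^ t * exp (\<theta> * (2 * h))"
        using pot_le C \<rho> by (intro mult_left_mono) auto
      finally show ?thesis by (simp add: mult_ac)
    qed
    have "\<bar>evolve p f t (mix 0) - evolve p f t (mix n)\<bar> \<le> real n * (?c * \<rho> ^ t)" for n
    proof (induction n)
      case (Suc n)
      then show ?case using step[of n] by (simp add: distrib_right)
    qed simp
    moreover have "evolve p f t (mix 0) = evolve p f t \<eta>"
      by (rule evolve_local[OF f(1) loc]) (auto simp: mix_def)
    moreover have "evolve p f t (mix (2 * m + 1 + t)) = evolve p f t \<xi>"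
      by (rule evolve_local[OF f(1) loc]) (auto simp: mix_def)
    ultimately show ?thesis by metis
  qed
  have "(\<lambda>t. ?c * (real (2 * m + 1) * \<rho> ^ t + real t * \<rho> ^ t)) \<longlonglongrightarrow> ?c * (real (2 * m + 1) * 0 + 0)"
    using \<rho> by (intro tendsto_intros LIMSEQ_power_zero powser_times_n_limit_0) auto
  then have "(\<lambda>t. real (2 * m + 1 + t) * (?c * \<rho> ^ t)) \<longlonglongrightarrow> 0"
    by (simp add: algebra_simps)
  then have "\<forall>\<^sub>F t in sequentially. real (2 * m + 1 + t) * (?c * \<rho> ^ t) < e"
    using \<open>0 < e\<close> by (rule order_tendstoD)
  then show ?thesis
    by eventually_elim (use osc le_less_trans in blast)
qed

lemma evolve_oscillation:
  assumes cond: "2 - r_all p > mean_rate False + mean_rate True"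
    and f: "continuous_on UNIV f" and "0 < e"
  shows "\<forall>\<^sub>F t in sequentially. \<forall>\<eta> \<xi>. \<bar>evolve p f t \<eta> - evolve p f t \<xi>\<bar> < e"
proof -
  obtain m where m: "\<And>x y. (\<And>i. \<bar>i\<bar> \<le> int m \<Longrightarrow> x i = y i) \<Longrightarrow> \<bar>f x - f y\<bar> < e / 3"
    using continuous_almost_local[OF f, of "e / 3"] \<open>0 < e\<close> by auto
  obtain B where B: "\<And>x. \<bar>f x\<bar> \<le> B" using continuous_bounded_configs[OF f] by blast
  \<comment> \<open>A local observable uniformly within \<open>e / 3\<close> of \<open>f\<close>:
    sites outside the window are reset to 0.\<close>
  define g where "g x = f (\<lambda>i. if \<bar>i\<bar> \<le> int m then x i else False)" for x
  have "continuous_on UNIV (\<lambda>x :: config. \<lambda>i. if \<bar>i\<bar> \<le> int m then x i else False)"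
  proof (rule continuous_on_coordinatewise_then_product)
    fix i :: int
    show "continuous_on UNIV (\<lambda>x :: config. if \<bar>i\<bar> \<le> int m then x i else False)"
      by (cases "\<bar>i\<bar> \<le> int m") simp_all
  qed
  then have "continuous_on UNIV g"
    unfolding g_def by (rule continuous_on_compose2[OF f]) auto
  then have gm: "g \<in> borel_measurable configs" by (rule borel_measurable_configs_continuous)
  have gB: "\<bar>g x\<bar> \<le> B" for x unfolding g_def by (rule B)
  have fm: "f \<in> borel_measurable configs" using f by (rule borel_measurable_configs_continuous)
  have "\<bar>f x - g x\<bar> \<le> e / 3" for x
    unfolding g_def by (intro less_imp_le m) auto
  then have fg: "\<bar>evolve p f t \<eta> - evolve p g t \<eta>\<bar> \<le> e / 3" for t \<eta>
    by (rule evolve_diff_le[OF fm B gm gB])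
  have "\<forall>\<^sub>F t in sequentially. \<forall>\<eta> \<xi>. \<bar>evolve p g t \<eta> - evolve p g t \<xi>\<bar> < e / 3"
  proof (rule evolve_oscillation_local[OF cond gm gB])
    fix x y :: config assume "\<And>i. \<bar>i\<bar> \<le> int m \<Longrightarrow> x i = y i"
    then have "(\<lambda>i. if \<bar>i\<bar> \<le> int m then x i else False) = (\<lambda>i. if \<bar>i\<bar> \<le> int m then y i else False)"
      by auto
    then show "g x = g y" by (simp add: g_def)
  qed (use \<open>0 < e\<close> in auto)
  then show ?thesis
  proof eventually_elim
    case (elim t)
    show ?case
    proof (intro allI)
      fix \<eta> \<xi>
      show "\<bar>evolve p f t \<eta> - evolve p f t \<xi>\<bar> < e"
        using fg[of t \<eta>] fg[of t \<xi>] elim[rule_format, of \<eta> \<xi>] by linarith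
    qed
  qed
qed

text \<open>Once the oscillation is small at time \<open>T\<close>, the integrals of
  \<open>f\<close> under all laws from time \<open>T\<close> on lie in one short interval around
  \<open>c\<close>, and so does the integral under the subsequential limit.\<close>

lemma ergodic:
  assumes cond: "2 - r_all p > mean_rate False + mean_rate True"
  shows "pca_ergodic p"
proof -
  \<comment> \<open>The starting law used to produce the candidate limit is arbitrary.\<close>
  define \<mu>' where "\<mu>' = pca_kernel p (\<lambda>_. False)"
  have \<mu>': "config_distribution \<mu>'" unfolding \<mu>'_def by (rule config_distribution_kernel)
  obtain r \<nu> where r: "strict_mono (r :: nat \<Rightarrow> nat)" and \<nu>: "config_distribution \<nu>"
    and conv: "\<And>f :: config \<Rightarrow> real. continuous_on UNIV f \<Longrightarrow>
      (\<lambda>n. \<integral>x. f x \<partial>pca_law p \<mu>' (r n)) \<longlonglongrightarrow> (\<integral>x. f x \<partial>\<nu>)"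
    using weak_limit_exists[of "pca_law p \<mu>'"] config_distribution_pca_law[OF \<mu>'] by metis
  have "weakly_converges (pca_law p \<mu>0) \<nu>" if \<mu>0: "config_distribution \<mu>0" for \<mu>0
    unfolding weakly_converges_def
  proof (intro allI impI)
    fix f :: "config \<Rightarrow> real" assume "continuous_on UNIV f \<and> bounded (range f)"
    then have f: "continuous_on UNIV f" by simp
    then have fm: "f \<in> borel_measurable configs" by (rule borel_measurable_configs_continuous)
    obtain B where B: "\<And>x. \<bar>f x\<bar> \<le> B" using continuous_bounded_configs[OF f] by blast
    show "(\<lambda>t. \<integral>x. f x \<partial>pca_law p \<mu>0 t) \<longlonglongrightarrow> (\<integral>x. f x \<partial>\<nu>)"
    proof (rule LIMSEQ_I)
      fix e :: real assume "0 < e"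
      then have "\<forall>\<^sub>F t in sequentially. \<forall>\<eta> \<xi>. \<bar>evolve p f t \<eta> - evolve p f t \<xi>\<bar> < e / 3"
        using evolve_oscillation[OF cond f, of "e / 3"] by simp
      then obtain T where T: "\<And>\<eta> \<xi>. \<bar>evolve p f T \<eta> - evolve p f T \<xi>\<bar> < e / 3"
        by (auto simp: eventually_sequentially)
      define c where "c = evolve p f T undefined"
      have "c - e / 3 \<le> evolve p f T x \<and> evolve p f T x \<le> c + e / 3" for x
        using T[of x undefined] unfolding c_def by linarith
      then have near: "c - e / 3 \<le> evolve p f t x \<and> evolve p f t x \<le> c + e / 3" if "T \<le> t" for t x
        using evolve_between[OF fm] that by blast
      have law: "c - e / 3 \<le> (\<integral>x. f x \<partial>pca_law p \<mu> t) \<and> (\<integral>x. f x \<partial>pca_law p \<mu> t) \<le> c + e / 3"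
        if "config_distribution \<mu>" "T \<le> t" for \<mu> t
        unfolding integral_pca_law[OF that(1) fm B]
        by (rule integral_config_distribution_between[OF that(1) evolve_measurable[OF fm] near[OF that(2)]])
      have late: "T \<le> r n" if "T \<le> n" for n using that seq_suble[OF r, of n] by linarith
      have "c - e / 3 \<le> (\<integral>x. f x \<partial>\<nu>)" "(\<integral>x. f x \<partial>\<nu>) \<le> c + e / 3"
        using law[OF \<mu>' late] by (intro LIMSEQ_le_const[OF conv[OF f]] LIMSEQ_le_const2[OF conv[OF f]]; blast)+
      then have "norm ((\<integral>x. f x \<partial>pca_law p \<mu>0 t) - (\<integral>x. f x \<partial>\<nu>)) < e" if "T \<le> t" for t
        using law[OF \<mu>0 that] \<open>0 < e\<close> unfolding real_norm_def by linarith
      then show "\<exists>T. \<forall>t\<ge>T. norm ((\<integral>x. f x \<partial>pca_law p \<mu>0 t) - (\<integral>x. f x \<partial>\<nu>)) < e" by blast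
    qed
  qed
  with \<nu> show ?thesis unfolding pca_ergodic_def by blast
qed

end

theorem theorem2:
  fixes p :: "bool \<Rightarrow> bool \<Rightarrow> real"
  assumes "\<And>a b. 0 < p a b \<and> p a b < 1"
    and "2 - r_all p >
           min (r_sup p False False) (r_sup p False True)
         + (1 - gamma_sup p False) * \<bar>r_sup p False False - r_sup p False True\<bar>
         + min (r_sup p True False) (r_sup p True True)
         + (1 - gamma_sup p True) * \<bar>r_sup p True False - r_sup p True True\<bar>"
  shows "pca_ergodic p"
proof -
  interpret positive_rates p by standard (rule assms(1))
  show ?thesis using assms(2) by (intro ergodic) (simp add: mean_rate_def)
qed

end
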